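(* Let $d\in\mathbb{N}$, $d\geq 1$. (i) Every matrix QMF system $(\boldsymbol{a}_1,\dots,\boldsymbol{a}_d,\boldsymbol{b}_1,\dots,\boldsymbol{b}_d)$ in $L^2(\mathbb{Z})^d$ that can be obtained through the construction (that is, as the image of the trivial QMF system under a finite product of operators $U_0(\boldsymbol{M})$, $U_1(\boldsymbol{M})$ with $\boldsymbol{M}\in O(2d)$) has outermost blocks, for the even or for the odd covering of $\mathbb{Z}$, of dimension $\leq d$. (ii) Conversely, every matrix QMF system of finite support length whose outermost blocks (leftmost and rightmost), for the even or for the odd covering of $\mathbb{Z}$, have dimension equal to $d$ can be obtained through the construction.
   Context: $L^2(\mathbb{Z})^d$ denotes the space of square-summable sequences $\boldsymbol{s}:\mathbb{Z}\to\mathbb{R}^d$ with scalar product $\langle \boldsymbol{a},\boldsymbol{b}\rangle=\sum_{k\in\mathbb{Z}}\sum_{i=1}^d a_i(k)b_i(k)$. For $n\in\mathbb{Z}$, $T_n$ is the translation operator $T_n\boldsymbol{s}=\boldsymbol{s}(\cdot-n)$, and $\delta_n$ is the scalar sequence with $\delta_n(n)=1$ and $\delta_n(k)=0$ for $k\neq n$. The canonical basis of $\mathbb{R}^d$ is $\boldsymbol{e}_1,\dots,\boldsymbol{e}_d$. **Matrix QMF system.** A matrix QMF system is a collection of $2d$ sequences $\boldsymbol{a}_1,\dots,\boldsymbol{a}_d,\boldsymbol{b}_1,\dots,\boldsymbol{b}_d\in L^2(\mathbb{Z})^d$ (equivalently, two $d\times d$ matrix sequences $\boldsymbol{A}=[\boldsymbol{a}_1,\dots,\boldsymbol{a}_d]$,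 $\boldsymbol{B}=[\boldsymbol{b}_1,\dots,\boldsymbol{b}_d]$) such that the set of even translates $\{T_{2m}\boldsymbol{a}_i,\ T_{2m}\boldsymbol{b}_i : m\in\mathbb{Z},\ i=1,\dots,d\}$ is an orthonormal basis of $L^2(\mathbb{Z})^d$. It has finite support length if all $2d$ sequences are finitely supported. The trivial QMF system is $\boldsymbol{a}_l=\boldsymbol{e}_l\delta_0$, $\boldsymbol{b}_l=\boldsymbol{e}_l\delta_1$, $l=1,\dots,d$. **The construction.** Let $O(2d)$ be the group of real orthogonal $2d\times 2d$ matrices. For $\boldsymbol{M}\in O(2d)$, the operator $U_0(\boldsymbol{M})$ on $L^2(\mathbb{Z})^d$ maps $\boldsymbol{s}$ to the sequence $\boldsymbol{s}'$ given, for every $n\in\mathbb{Z}$, by $$\begin{bmatrix}\boldsymbol{s}'(2n)\\ \boldsymbol{s}'(2n+1)\end{bmatrix}=\boldsymbol{M}\begin{bmatrix}\boldsymbol{s}(2n)\\ \boldsymbol{s}(2n+1)\end{bmatrix},$$ and $U_1(\boldsymbol{M})=T_{-1}U_0(\boldsymbol{M})T_1$, i.e. $U_1(\boldsymbol{M})$ multiplies each vector $[\boldsymbol{s}(2n-1)^T\ \boldsymbol{s}(2n)^T]^T$, $n\in\mathbb{Z}$, by $\boldsymbol{M}$. These operators are orthogonal and commute with $T_2$, so they map QMF systems to QMF systems. A QMF system can be obtained through the construction if there are $K\in\mathbb{N}$, matrices $\boldsymbol{M}_0,\dots,\boldsymbol{M}_{K-1}\in O(2d)$ and $\epsilon_0,\dots,\epsilon_{K-1}\in\{0,1\}$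 such that, with $$U=U_{\epsilon_{K-1}}(\boldsymbol{M}_{K-1})\cdots U_{\epsilon_1}(\boldsymbol{M}_1)\,U_{\epsilon_0}(\boldsymbol{M}_0),$$ one has $\boldsymbol{a}_l=U(\boldsymbol{e}_l\delta_0)$ and $\boldsymbol{b}_l=U(\boldsymbol{e}_l\delta_1)$ for $l=1,\dots,d$. **Blocks.** The even covering of $\mathbb{Z}$ consists of the blocks $\{2n,2n+1\}$, $n\in\mathbb{Z}$; the odd covering consists of the blocks $\{2n-1,2n\}$, $n\in\mathbb{Z}$. Given a finitely supported QMF system, let $J$ be the smallest interval of integers containing the supports of all $2d$ sequences of the system. The outermost blocks of the even (respectively odd) covering are the leftmost and the rightmost blocks of that covering that intersect $J$. The dimension of a block $\{m,m+1\}$ is the dimension of the linear subspace of $\mathbb{R}^{2d}$ spanned by the $2d$ vectors $[\boldsymbol{s}(m)^T\ \boldsymbol{s}(m+1)^T]^T$, where $\boldsymbol{s}$ runs over $\boldsymbol{a}_1,\dots,\boldsymbol{a}_d,\boldsymbol{b}_1,\dots,\boldsymbol{b}_d$.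
   Formalization: (ii) is false as stated (d=1, a=δ_0, b=δ_3); what is proved is that the system translated by -c can be obtained, where c is the mean of the left endpoints of the leftmost and rightmost blocks of the covering; for c=0 this is the literal claim, and for c≠0 the literal claim fails. *)

theory Defs
  imports "HOL-Analysis.Analysis"
begin

text \<open>The Hilbert space of square-summable vector sequences. The inner product of
  \<^typ>\<open>real^'d\<close> is the sum over the components.\<close>

type_synonym 'd vseq = "int \<Rightarrow> real ^ 'd"

definition l2 :: "'d::finite vseq set" where
  "l2 = {s. (\<lambda>k. (norm (s k))\<^sup>2) summable_on UNIV}"

definition l2_inner :: "'d::finite vseq \<Rightarrow> 'd vseq \<Rightarrow> real" where
  "l2_inner s t = (\<Sum>\<^sub>\<infinity>k. s k \<bullet> t k)"

definition l2_norm :: "'d::finite vseq \<Rightarrow> real" where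
  "l2_norm s = sqrt (l2_inner s s)"

definition l2_orthonormal_basis :: "('i \<Rightarrow> 'd::finite vseq) \<Rightarrow> bool" where
  "l2_orthonormal_basis f \<longleftrightarrow>
     (\<forall>i. f i \<in> l2) \<and>
     (\<forall>i j. l2_inner (f i) (f j) = (if i = j then 1 else 0)) \<and>
     (\<forall>s\<in>l2. \<forall>\<epsilon>>0. \<exists>F c. finite F \<and> l2_norm (\<lambda>k. s k - (\<Sum>i\<in>F. c i *\<^sub>R f i k)) < \<epsilon>)"

definition translate :: "int \<Rightarrow> 'd::finite vseq \<Rightarrow> 'd vseq" where
  "translate n s = (\<lambda>k. s (k - n))"

definition unit_seq :: "'d::finite \<Rightarrow> int \<Rightarrow> 'd vseq" where
  "unit_seq l n = (\<lambda>k. if k = n then axis l 1 else 0)"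

text \<open>A pair \<open>a b\<close> of \<open>'d\<close>-indexed families stands for the \<open>2d\<close> sequences. The even
  translates are taken as a family, so distinct indices give distinct basis vectors.\<close>

definition qmf_system :: "('d::finite \<Rightarrow> 'd vseq) \<Rightarrow> ('d \<Rightarrow> 'd vseq) \<Rightarrow> bool" where
  "qmf_system a b \<longleftrightarrow>
     l2_orthonormal_basis (\<lambda>(j :: 'd + 'd, m). translate (2 * m) (case_sum a b j))"

definition qmf_support :: "('d::finite \<Rightarrow> 'd vseq) \<Rightarrow> ('d \<Rightarrow> 'd vseq) \<Rightarrow> int set" where
  "qmf_support a b = {k. \<exists>l. a l k \<noteq> 0 \<or> b l k \<noteq> 0}"

text \<open>Vectors of length \<open>2d\<close> are indexed by \<open>'d + 'd\<close>: \<open>Inl\<close> is the upper half,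
  \<open>Inr\<close> the lower half.\<close>

definition block_vec :: "'d::finite vseq \<Rightarrow> int \<Rightarrow> real ^ ('d + 'd)" where
  "block_vec s m = (\<chi> j. case j of Inl i \<Rightarrow> s m $ i | Inr i \<Rightarrow> s (m + 1) $ i)"

definition U0 :: "real ^ ('d + 'd) ^ ('d + 'd) \<Rightarrow> 'd::finite vseq \<Rightarrow> 'd vseq" where
  "U0 M s = (\<lambda>k. if even k then (\<chi> i. (M *v block_vec s k) $ Inl i)
                 else (\<chi> i. (M *v block_vec s (k - 1)) $ Inr i))"

definition U1 :: "real ^ ('d + 'd) ^ ('d + 'd) \<Rightarrow> 'd::finite vseq \<Rightarrow> 'd vseq" where
  "U1 M s = translate (-1) (U0 M (translate 1 s))"

primrec U_prod ::
  "(nat \<Rightarrow> nat) \<Rightarrow> (nat \<Rightarrow> real ^ ('d + 'd) ^ ('d + 'd)) \<Rightarrow> nat \<Rightarrow> 'd::finite vseq \<Rightarrow> 'd vseq"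
where
  "U_prod e M 0 s = s"
| "U_prod e M (Suc k) s = (if e k = 0 then U0 (M k) else U1 (M k)) (U_prod e M k s)"

definition obtainable :: "('d::finite \<Rightarrow> 'd vseq) \<Rightarrow> ('d \<Rightarrow> 'd vseq) \<Rightarrow> bool" where
  "obtainable a b \<longleftrightarrow>
     (\<exists>K e M. (\<forall>k<K. e k \<in> {0, 1} \<and> orthogonal_matrix (M k)) \<and>
        (\<forall>l. a l = U_prod e M K (unit_seq l 0) \<and> b l = U_prod e M K (unit_seq l 1)))"

text \<open>A block \<open>{m, m + 1}\<close> is represented by its left endpoint \<open>m\<close>, a covering by the set
  of left endpoints of its blocks.\<close>

definition even_covering :: "int set" where
  "even_covering = {m. even m}"

definition odd_covering :: "int set" where
  "odd_covering = {m. odd m}"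

text \<open>The notions below are meaningful for systems with finite nonempty support.\<close>

definition support_interval :: "('d::finite \<Rightarrow> 'd vseq) \<Rightarrow> ('d \<Rightarrow> 'd vseq) \<Rightarrow> int set" where
  "support_interval a b = {Min (qmf_support a b)..Max (qmf_support a b)}"

definition leftmost_block ::
  "int set \<Rightarrow> ('d::finite \<Rightarrow> 'd vseq) \<Rightarrow> ('d \<Rightarrow> 'd vseq) \<Rightarrow> int" where
  "leftmost_block C a b = Min {m \<in> C. {m, m + 1} \<inter> support_interval a b \<noteq> {}}"

definition rightmost_block ::
  "int set \<Rightarrow> ('d::finite \<Rightarrow> 'd vseq) \<Rightarrow> ('d \<Rightarrow> 'd vseq) \<Rightarrow> int" where
  "rightmost_block C a b = Max {m \<in> C. {m, m + 1} \<inter> support_interval a b \<noteq> {}}"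

definition block_dim :: "('d::finite \<Rightarrow> 'd vseq) \<Rightarrow> ('d \<Rightarrow> 'd vseq) \<Rightarrow> int \<Rightarrow> nat" where
  "block_dim a b m = dim (range (\<lambda>l. block_vec (a l) m) \<union> range (\<lambda>l. block_vec (b l) m))"

text \<open>Every factor \<open>U0 M\<close>, \<open>U1 M\<close> has a polyphase matrix of constant determinant, so an
  obtainable system has no overall delay. Systems whose blocks are not centred at \<open>{0, 1}\<close>,
  such as \<open>unit_seq l 0, unit_seq l 3\<close> for \<open>d = 1\<close>, are therefore only obtainable after a
  translation. The delay of a system whose outermost blocks have dimension \<open>d\<close> is the mean of
  their positions; the sum below is always even.\<close>

definition covering_centre ::
  "int set \<Rightarrow> ('d::finite \<Rightarrow> 'd vseq) \<Rightarrow> ('d \<Rightarrow> 'd vseq) \<Rightarrow> int" where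
  "covering_centre C a b = (leftmost_block C a b + rightmost_block C a b) div 2"

end

theory Submission
  imports Defs
begin

text \<open>Both parts rest on the fact that the rotations of the blocks of one covering are orthogonal
  operators which commute with even translations and are inverted by the transposed rotations.

  Part (ii) is an induction on the length of the support (\<open>reachable_if_ends_full\<close>). If the outermost
  blocks are different, a suitable translate of one sequence meets another sequence only in
  its opposite outermost block, so the two outermost blocks span orthogonal subspaces of dimension
  \<open>d\<close> of a space of dimension \<open>2d\<close>. One rotation moves these to the inner halves of their blocks.
  The support loses a position at either end, and the blocks of the other covering that are now
  outermost satisfy the same dimension condition. What remains in the end lives on one block and is a
  rotation of the trivial system. Both ends move inwards at the same speed, so this last block is the
  centre of the support, and translating the centre to 0 makes it the block of the trivial system.

  Part (i) compares two estimates of the centre of mass. For a family whose even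
  translates are orthonormal and complete, the total energy is \<open>2d\<close>, of which \<open>d\<close> lies on the
  even and \<open>d\<close> on the odd positions. Hence the total moment \<open>\<Sum>k. k * |s k|^2\<close> can be computed from
  the energies of the blocks of either covering, and no rotation changes it (\<open>total_moment_rotate\<close>). For an
  obtainable system it has the value \<open>d\<close> of the trivial system: the centre of mass is \<open>1/2\<close>. On the
  other hand, if the first of \<open>N + 1\<close> consecutive blocks has dimension \<open>A\<close>, then the block moment
  is at most \<open>N * (2d - A)\<close> (\<open>moment_le_codim_first\<close>), and symmetrically at the other end. So a block of
  dimension above \<open>d\<close> on the left, or on the right, pulls the centre of mass strictly to its side of the middle.
  For a support with end points \<open>p\<close> and \<open>q\<close>, oversized blocks at the left end in one covering and at
  the right end in the other would require \<open>0 < p + q < 2\<close>. If \<open>p\<close> and \<open>q\<close> have equal parity, this is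
  impossible. If they differ in parity, one covering has an outermost block at each end that is
  half empty, and then its dimension is at most \<open>d\<close>.\<close>

section \<open>Finitely supported sequences\<close>

definition finsupp :: "'n::finite vseq \<Rightarrow> bool" where
  "finsupp s \<longleftrightarrow> finite {k. s k \<noteq> 0}"

lemma summable_on_finsupp:
  fixes f :: "int \<Rightarrow> real"
  assumes "finsupp s" "\<And>k. s k = 0 \<Longrightarrow> f k = 0"
  shows "f summable_on A"
proof (rule finite_nonzero_values_imp_summable_on, rule finite_subset)
  show "{x \<in> A. f x \<noteq> 0} \<subseteq> {k. s k \<noteq> 0}" using assms(2) by auto
  show "finite {k. s k \<noteq> 0}" using assms(1) by (simp add: finsupp_def)
qed

lemma finsupp_reindex:
  assumes "finsupp s" "inj g" "\<And>k. s (g k) = 0 \<Longrightarrow> t k = 0"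
  shows "finsupp t"
proof -
  have "{k. t k \<noteq> 0} \<subseteq> g -` {k. s k \<noteq> 0}" using assms(3) by auto
  then show ?thesis
    using assms(1,2) finite_vimageI[of "{k. s k \<noteq> 0}" g] finite_subset
    unfolding finsupp_def by blast
qed

lemma finsupp_interval:
  assumes "\<And>k. k \<notin> {a..b} \<Longrightarrow> s k = 0"
  shows "finsupp s"
  unfolding finsupp_def by (rule finite_subset[of _ "{a..b}"]) (use assms in blast, simp)

lemma finsupp_union:
  assumes "finsupp s" "finsupp t" "\<And>k. s k = 0 \<Longrightarrow> t k = 0 \<Longrightarrow> u k = 0"
  shows "finsupp u"
proof -
  have "{k. u k \<noteq> 0} \<subseteq> {k. s k \<noteq> 0} \<union> {k. t k \<noteq> 0}" using assms(3) by auto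
  then show ?thesis using assms(1,2) finite_subset unfolding finsupp_def by blast
qed

lemma finsupp_translate: "finsupp s \<Longrightarrow> finsupp (translate n s)"
  by (rule finsupp_reindex[of s "\<lambda>k. k - n"]) (auto simp: translate_def inj_def)

lemma infsum_shift: "(\<Sum>\<^sub>\<infinity>k. f (k + c :: int)) = (\<Sum>\<^sub>\<infinity>k. f k)"
  by (rule infsum_reindex_bij_betw)
     (auto intro!: bij_betwI[of _ _ _ "\<lambda>k. k - c"])

lemma infsum_uminus_arg: "(\<Sum>\<^sub>\<infinity>k. f (- k :: int)) = (\<Sum>\<^sub>\<infinity>k. f k)"
  by (rule infsum_reindex_bij_betw) (auto intro!: bij_betwI[of _ _ _ uminus])

lemma infsum_int_parity:
  fixes g :: "int \<Rightarrow> real"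
  assumes "\<And>A. g summable_on A"
  shows "(\<Sum>\<^sub>\<infinity>k. g k) = (\<Sum>\<^sub>\<infinity>n. g (2 * n + p) + g (2 * n + p + 1))"
proof -
  let ?e = "\<lambda>n::int. 2 * n + p" and ?o = "\<lambda>n::int. 2 * n + p + 1"
  have e: "inj ?e" and o: "inj ?o" by (auto simp: inj_def)
  have "k \<in> range ?e \<union> range ?o" for k
  proof (cases "even (k - p)")
    case True
    then obtain n where "k - p = 2 * n" by (elim evenE)
    then have "k = ?e n" by simp
    then show ?thesis by blast
  next
    case False
    then obtain n where "k - p = 2 * n + 1" by (elim oddE)
    then have "k = ?o n" by simp
    then show ?thesis by blast
  qed
  then have U: "range ?e \<union> range ?o = UNIV" by blast
  have "even (?e n - p)" "odd (?o n - p)" for n by auto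
  then have D: "range ?e \<inter> range ?o = {}" by (smt (verit) disjoint_iff imageE)
  have "(\<Sum>\<^sub>\<infinity>k. g k) = infsum g (range ?e) + infsum g (range ?o)"
    using infsum_Un_disjoint[OF assms assms D] U by simp
  also have "\<dots> = (\<Sum>\<^sub>\<infinity>n. g (?e n)) + (\<Sum>\<^sub>\<infinity>n. g (?o n))"
    using infsum_reindex[OF e, of g] infsum_reindex[OF o, of g] by (simp add: o_def)
  also have "\<dots> = (\<Sum>\<^sub>\<infinity>n. g (?e n) + g (?o n))"
    using summable_on_reindex[OF e, of g] summable_on_reindex[OF o, of g] assms
    by (subst infsum_add) (auto simp: o_def)
  finally show ?thesis .
qed

lemma infsum_diff:
  fixes f g :: "int \<Rightarrow> real"
  assumes "f summable_on A" "g summable_on A"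
  shows "infsum (\<lambda>k. f k - g k) A = infsum f A - infsum g A"
  using infsum_add[OF assms(1), of "\<lambda>k. - g k"] summable_on_uminus[of g A] assms(2) infsum_uminus[of g A] by simp

lemma infsum_finite_sum:
  fixes f :: "'b \<Rightarrow> 'a \<Rightarrow> real"
  assumes "finite B" "\<And>b. b \<in> B \<Longrightarrow> f b summable_on A"
  shows "infsum (\<lambda>k. \<Sum>b\<in>B. f b k) A = (\<Sum>b\<in>B. infsum (f b) A)"
proof (rule infsumI)
  show "((\<lambda>k. \<Sum>b\<in>B. f b k) has_sum (\<Sum>b\<in>B. infsum (f b) A)) A"
    using assms by (induction B rule: finite_induct) (auto intro!: has_sum_add)
qed

lemma l2_inner_translate: "l2_inner (translate n s) (translate n t) = l2_inner s t"
  using infsum_shift[of "\<lambda>k. s k \<bullet> t k" "-n"] by (simp add: l2_inner_def translate_def)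

lemma l2_inner_self: "l2_inner s s = (\<Sum>\<^sub>\<infinity>k. (norm (s k))\<^sup>2)"
  by (simp add: l2_inner_def power2_norm_eq_inner)

lemma l2_inner_single:
  assumes "\<And>k. k \<noteq> n \<Longrightarrow> s k \<bullet> t k = 0"
  shows "l2_inner s t = s n \<bullet> t n"
proof -
  have "l2_inner s t = (\<Sum>\<^sub>\<infinity>k\<in>{n}. s k \<bullet> t k)"
    unfolding l2_inner_def by (rule infsum_cong_neutral) (use assms in auto)
  then show ?thesis by simp
qed

section \<open>Block sequences and first moments\<close>

definition blocks :: "int \<Rightarrow> 'd::finite vseq \<Rightarrow> ('d + 'd) vseq" where
  "blocks p s = (\<lambda>n. block_vec s (2 * n + p))"

lemma sum_UNIV_Plus: "(\<Sum>j\<in>(UNIV :: ('a::finite + 'b::finite) set). f j) = (\<Sum>i\<in>UNIV. f (Inl i)) + (\<Sum>i\<in>UNIV. f (Inr i))"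
  by (simp flip: UNIV_Plus_UNIV add: sum.Plus)

lemma inner_block_vec: "block_vec s m \<bullet> block_vec t m = s m \<bullet> t m + s (m + 1) \<bullet> t (m + 1)"
  by (simp add: inner_vec_def block_vec_def sum_UNIV_Plus)

lemma block_vec_eq_0_iff: "block_vec s m = 0 \<longleftrightarrow> s m = 0 \<and> s (m + 1) = 0"
proof -
  have "block_vec s m = 0 \<longleftrightarrow> block_vec s m \<bullet> block_vec s m = 0" by simp
  also have "\<dots> \<longleftrightarrow> s m = 0 \<and> s (m + 1) = 0"
    unfolding inner_block_vec by (simp add: add_nonneg_eq_0_iff)
  finally show ?thesis .
qed

text \<open>The inverse of \<open>blocks p\<close>. That \<open>blocks p\<close> is a bijection allows identities of sequences to be
  checked on the blocks of either covering, and carries completeness over to block sequences.\<close>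
definition unblocks :: "int \<Rightarrow> ('d + 'd) vseq \<Rightarrow> 'd::finite vseq" where
  "unblocks p x = (\<lambda>k. \<chi> i. x ((k - p) div 2) $ (if even (k - p) then Inl i else Inr i))"

lemma blocks_unblocks: "blocks p (unblocks p x) = x"
proof
  fix n
  have "blocks p (unblocks p x) n $ j = x n $ j" for j
    by (cases j) (simp_all add: blocks_def unblocks_def block_vec_def)
  then show "blocks p (unblocks p x) n = x n" by (simp add: vec_eq_iff)
qed

lemma unblocks_blocks: "unblocks p (blocks p s) = s"
proof (rule ext)
  fix k
  show "unblocks p (blocks p s) k = s k"
  proof (cases "even (k - p)")
    case True
    then obtain n where "k - p = 2 * n" by (elim evenE)
    then have k: "k = 2 * n + p" by simp
    show ?thesis unfolding k by (simp add: blocks_def unblocks_def block_vec_def vec_eq_iff)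
  next
    case False
    then obtain n where "k - p = 2 * n + 1" by (elim oddE)
    then have k: "k = 2 * n + p + 1" by simp
    show ?thesis unfolding k by (simp add: blocks_def unblocks_def block_vec_def vec_eq_iff add.assoc)
  qed
qed

lemma blocks_eqD: "blocks p s = blocks p t \<Longrightarrow> s = t"
  by (metis unblocks_blocks)

lemma finsupp_blocks: "finsupp s \<Longrightarrow> finsupp (blocks p s)"
  by (rule finsupp_union[OF finsupp_reindex[of s "\<lambda>n. 2 * n + p" "\<lambda>n. s (2 * n + p)"]
        finsupp_reindex[of s "\<lambda>n. 2 * n + p + 1" "\<lambda>n. s (2 * n + p + 1)"]])
     (simp_all add: inj_def blocks_def block_vec_eq_0_iff)

lemma finsupp_unblocks:
  assumes "finsupp x"
  shows "finsupp (unblocks p x)"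
proof -
  have "{k. unblocks p x k \<noteq> 0} \<subseteq> (\<Union>n\<in>{n. x n \<noteq> 0}. {2 * n + p, 2 * n + p + 1})"
  proof
    fix k assume "k \<in> {k. unblocks p x k \<noteq> 0}"
    then have "x ((k - p) div 2) \<noteq> 0" by (auto simp: unblocks_def vec_eq_iff)
    moreover have "k = 2 * ((k - p) div 2) + p \<or> k = 2 * ((k - p) div 2) + p + 1" by presburger
    then have "k \<in> {2 * ((k - p) div 2) + p, 2 * ((k - p) div 2) + p + 1}" by blast
    ultimately show "k \<in> (\<Union>n\<in>{n. x n \<noteq> 0}. {2 * n + p, 2 * n + p + 1})" by blast
  qed
  then show ?thesis
    using assms finite_subset[OF _ finite_UN_I[of "{n. x n \<noteq> 0}" "\<lambda>n. {2 * n + p, 2 * n + p + 1}"]]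
    unfolding finsupp_def by simp
qed

lemma block_vec_translate: "block_vec (translate c s) m = block_vec s (m - c)"
proof -
  have "m - c + 1 = m + 1 - c" by simp
  then show ?thesis unfolding translate_def block_vec_def by metis
qed

lemma blocks_translate: "blocks p (translate (2 * m) s) = translate m (blocks p s)"
  unfolding blocks_def block_vec_translate by (simp add: translate_def algebra_simps)

lemma l2_inner_blocks:
  assumes "finsupp s"
  shows "l2_inner (blocks p s) (blocks p t) = l2_inner s t"
  unfolding l2_inner_def blocks_def inner_block_vec
  by (rule infsum_int_parity[symmetric]) (rule summable_on_finsupp[OF assms], simp)

text \<open>The centre of mass, up to the factor \<open>l2_inner s s\<close>. Summed over a family of block sequences
  whose translates are orthonormal and complete, it is the exponent of the monomial that is the determinant of the
  polyphase matrix, that is, the delay of the system. As a sum of squares it can be followed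
  through the construction without determinants.\<close>
definition moment :: "'n::finite vseq \<Rightarrow> real" where
  "moment s = (\<Sum>\<^sub>\<infinity>k. of_int k * (norm (s k))\<^sup>2)"

text \<open>Both positions of the block with left endpoint \<open>2 * n + p\<close> get the weight \<open>2 * n + p\<close>, which
  depends on the energy of the block only; the second position still lacks the weight one.\<close>
lemma moment_blocks:
  assumes "finsupp s"
  shows "moment s = 2 * moment (blocks p s) + p * l2_inner s s + (\<Sum>\<^sub>\<infinity>n. (norm (s (2 * n + p + 1)))\<^sup>2)"
proof -
  let ?B = "blocks p s"
  have B: "finsupp ?B" by (rule finsupp_blocks[OF assms])
  have nB: "(norm (?B n))\<^sup>2 = (norm (s (2 * n + p)))\<^sup>2 + (norm (s (2 * n + p + 1)))\<^sup>2" for n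
    by (simp add: power2_norm_eq_inner blocks_def inner_block_vec)
  have z: "s (2 * n + p + 1) = 0" if "?B n = 0" for n
    using that by (simp add: blocks_def block_vec_eq_0_iff)
  have "moment s = (\<Sum>\<^sub>\<infinity>n. of_int (2 * n + p) * (norm (s (2 * n + p)))\<^sup>2
                      + of_int (2 * n + p + 1) * (norm (s (2 * n + p + 1)))\<^sup>2)"
    unfolding moment_def by (rule infsum_int_parity) (rule summable_on_finsupp[OF assms], simp)
  also have "\<dots> = (\<Sum>\<^sub>\<infinity>n. (2 * (of_int n * (norm (?B n))\<^sup>2) + of_int p * (norm (?B n))\<^sup>2)
                      + (norm (s (2 * n + p + 1)))\<^sup>2)"
    by (rule infsum_cong) (simp add: nB algebra_simps)
  also have "\<dots> = (\<Sum>\<^sub>\<infinity>n. 2 * (of_int n * (norm (?B n))\<^sup>2) + of_int p * (norm (?B n))\<^sup>2)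
                      + (\<Sum>\<^sub>\<infinity>n. (norm (s (2 * n + p + 1)))\<^sup>2)"
    by (rule infsum_add; rule summable_on_finsupp[OF B]; simp add: z)
  also have "(\<Sum>\<^sub>\<infinity>n. 2 * (of_int n * (norm (?B n))\<^sup>2) + of_int p * (norm (?B n))\<^sup>2)
      = (\<Sum>\<^sub>\<infinity>n. 2 * (of_int n * (norm (?B n))\<^sup>2)) + (\<Sum>\<^sub>\<infinity>n. of_int p * (norm (?B n))\<^sup>2)"
    by (rule infsum_add; rule summable_on_finsupp[OF B]; simp)
  also have "\<dots> = 2 * moment ?B + p * l2_inner ?B ?B"
    by (simp add: infsum_cmult_right' moment_def l2_inner_self)
  finally show ?thesis by (simp add: l2_inner_blocks[OF assms])
qed

section \<open>Orthonormal and complete families of translates\<close>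

definition orthonormal_translates :: "int \<Rightarrow> ('j \<Rightarrow> 'n::finite vseq) \<Rightarrow> bool" where
  "orthonormal_translates t h \<longleftrightarrow>
     (\<forall>i j m. l2_inner (h i) (translate (t * m) (h j)) = (if i = j \<and> m = 0 then 1 else 0))"

text \<open>Completeness is tested on finitely supported sequences only. Together with finite support
  of the family this makes all series below finite sums.\<close>
definition parseval_translates :: "int \<Rightarrow> ('j::finite \<Rightarrow> 'n::finite vseq) \<Rightarrow> bool" where
  "parseval_translates t h \<longleftrightarrow>
     (\<forall>v. finsupp v \<longrightarrow> (\<Sum>j\<in>UNIV. \<Sum>\<^sub>\<infinity>m. (l2_inner v (translate (t * m) (h j)))\<^sup>2) = l2_inner v v)"

text \<open>The two step widths \<open>t\<close> and \<open>t'\<close> cover the passage to blocks, which turns even translates into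
  all translates (\<open>2\<close> and \<open>1\<close>), and the reversal of time (\<open>1\<close> and \<open>-1\<close>).\<close>
definition shift_isometry :: "int \<Rightarrow> int \<Rightarrow> ('m::finite vseq \<Rightarrow> 'n::finite vseq) \<Rightarrow> bool" where
  "shift_isometry t t' \<Phi> \<longleftrightarrow>
     (\<forall>s. finsupp s \<longrightarrow> finsupp (\<Phi> s)) \<and>
     (\<forall>s u. finsupp s \<longrightarrow> finsupp u \<longrightarrow> l2_inner (\<Phi> s) (\<Phi> u) = l2_inner s u) \<and>
     (\<forall>s m. \<Phi> (translate (t * m) s) = translate (t' * m) (\<Phi> s)) \<and>
     (\<forall>v. finsupp v \<longrightarrow> (\<exists>s. finsupp s \<and> \<Phi> s = v))"

lemma orthonormal_translates_image:
  assumes "shift_isometry t t' \<Phi>" "\<And>j. finsupp (h j)" "orthonormal_translates t h"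
  shows "orthonormal_translates t' (\<lambda>j. \<Phi> (h j))"
  using assms unfolding orthonormal_translates_def shift_isometry_def
  by (metis finsupp_translate)

text \<open>By surjectivity the test sequence is itself an image, and the isometry removes \<open>\<Phi>\<close> from
  every inner product.\<close>
lemma parseval_translates_image:
  assumes \<Phi>: "shift_isometry t t' \<Phi>" and h: "\<And>j. finsupp (h j)" "parseval_translates t h"
  shows "parseval_translates t' (\<lambda>j. \<Phi> (h j))"
  unfolding parseval_translates_def
proof (intro allI impI)
  fix v :: "'b vseq" assume "finsupp v"
  then obtain s where s: "finsupp s" and v: "v = \<Phi> s"
    using \<Phi> unfolding shift_isometry_def by metis
  have "l2_inner v (translate (t' * m) (\<Phi> (h j))) = l2_inner s (translate (t * m) (h j))" for m j
    using \<Phi> s h(1)[of j] finsupp_translate unfolding shift_isometry_def v by metis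
  moreover have "l2_inner v v = l2_inner s s"
    using \<Phi> s unfolding shift_isometry_def v by blast
  ultimately show "(\<Sum>j\<in>UNIV. \<Sum>\<^sub>\<infinity>m. (l2_inner v (translate (t' * m) (\<Phi> (h j))))\<^sup>2) = l2_inner v v"
    using h(2) s unfolding parseval_translates_def by simp
qed

lemma shift_isometry_blocks: "shift_isometry 2 1 (blocks p)"
  unfolding shift_isometry_def
  using finsupp_blocks l2_inner_blocks blocks_translate finsupp_unblocks blocks_unblocks
  by (metis mult_1)

text \<open>Translating one of the two sequences by \<open>N\<close> leaves a single position of overlap, where the
  first value of one meets the last value of the other.\<close>
lemma orthonormal_ends_orthogonal:
  assumes "orthonormal_translates 1 h" "\<And>j k. k \<notin> {0..N} \<Longrightarrow> h j k = 0" "N > 0"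
  shows "h i 0 \<bullet> h j N = 0"
proof -
  have "l2_inner (h j) (translate (1 * N) (h i)) = 0"
    using assms(1,3) unfolding orthonormal_translates_def by (metis less_irrefl)
  moreover have "l2_inner (h j) (translate N (h i)) = h j N \<bullet> translate N (h i) N"
  proof (rule l2_inner_single)
    fix k assume "k \<noteq> N"
    then have "k \<notin> {0..N} \<or> k - N \<notin> {0..N}" by auto
    then show "h j k \<bullet> translate N (h i) k = 0"
      using assms(2)[of k j] assms(2)[of "k - N" i] unfolding translate_def by fastforce
  qed
  ultimately show ?thesis by (simp add: translate_def inner_commute)
qed

text \<open>Completeness tested on the sequence that has the value \<open>u\<close> at position 0. In terms of the
  polyphase matrix: its rows are orthonormal.\<close>
lemma parseval_row_energy:
  assumes "parseval_translates 1 h"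
  shows "(\<Sum>j\<in>UNIV. \<Sum>\<^sub>\<infinity>m. (u \<bullet> h j m)\<^sup>2) = u \<bullet> u"
proof -
  let ?v = "\<lambda>k::int. if k = 0 then u else 0"
  have "finsupp ?v" by (rule finsupp_interval[of 0 0]) auto
  moreover have "l2_inner ?v (translate m (h j)) = u \<bullet> h j (- m)" for m j
    using l2_inner_single[of 0 ?v "translate m (h j)"] by (simp add: translate_def)
  moreover have "l2_inner ?v ?v = u \<bullet> u"
    using l2_inner_single[of 0 ?v ?v] by simp
  ultimately have "(\<Sum>j\<in>UNIV. \<Sum>\<^sub>\<infinity>m. (u \<bullet> h j (- m))\<^sup>2) = u \<bullet> u"
    using assms unfolding parseval_translates_def by (metis (no_types, lifting) mult_1 sum.cong infsum_cong)
  then show ?thesis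
    using infsum_uminus_arg[of "\<lambda>m. (u \<bullet> h _ m)\<^sup>2"] by simp
qed

text \<open>For an orthonormal \<open>B\<close> the left-hand side is the energy of the projection to \<open>span B\<close>.\<close>
lemma parseval_subspace_energy:
  assumes "parseval_translates 1 h" "\<And>j. finsupp (h j)" "finite B" "\<And>b. b \<in> B \<Longrightarrow> b \<bullet> b = 1"
  shows "(\<Sum>j\<in>UNIV. \<Sum>\<^sub>\<infinity>m. \<Sum>b\<in>B. (b \<bullet> h j m)\<^sup>2) = real (card B)"
proof -
  have "(\<Sum>j\<in>UNIV. \<Sum>\<^sub>\<infinity>m. \<Sum>b\<in>B. (b \<bullet> h j m)\<^sup>2) = (\<Sum>j\<in>UNIV. \<Sum>b\<in>B. \<Sum>\<^sub>\<infinity>m. (b \<bullet> h j m)\<^sup>2)"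
  proof (rule sum.cong[OF refl])
    fix j
    show "(\<Sum>\<^sub>\<infinity>m. \<Sum>b\<in>B. (b \<bullet> h j m)\<^sup>2) = (\<Sum>b\<in>B. \<Sum>\<^sub>\<infinity>m. (b \<bullet> h j m)\<^sup>2)"
      by (rule infsum_finite_sum[OF assms(3)], rule summable_on_finsupp[OF assms(2)[of j]]) simp
  qed
  also have "\<dots> = (\<Sum>b\<in>B. b \<bullet> b)"
    by (subst sum.swap) (simp add: parseval_row_energy[OF assms(1)])
  finally show ?thesis by (simp add: assms(4))
qed

lemma parseval_total_energy:
  fixes h :: "'j::finite \<Rightarrow> 'n::finite vseq"
  assumes "parseval_translates 1 h" "\<And>j. finsupp (h j)"
  shows "(\<Sum>j\<in>UNIV. \<Sum>\<^sub>\<infinity>m. (norm (h j m))\<^sup>2) = real CARD('n)"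
proof -
  have "(norm x)\<^sup>2 = (\<Sum>b\<in>Basis. (b \<bullet> x)\<^sup>2)" for x :: "real ^ 'n"
    unfolding power2_norm_eq_inner by (subst euclidean_inner) (simp add: power2_eq_square inner_commute)
  then show ?thesis
    using parseval_subspace_energy[OF assms, of Basis] by simp
qed

section \<open>Shifting one part of an orthogonal splitting\<close>

definition proj :: "'a::euclidean_space set \<Rightarrow> 'a \<Rightarrow> 'a" where
  "proj B x = (\<Sum>b\<in>B. (b \<bullet> x) *\<^sub>R b)"

definition orthonormal_set :: "'a::euclidean_space set \<Rightarrow> bool" where
  "orthonormal_set B \<longleftrightarrow> finite B \<and> (\<forall>x\<in>B. \<forall>y\<in>B. x \<bullet> y = (if x = y then 1 else 0))"

lemma orthonormal_basis_of_span:
  fixes S :: "'a::euclidean_space set"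
  obtains B where "orthonormal_set B" "card B = dim S" "span B = span S"
proof -
  obtain B where B: "pairwise orthogonal B" "\<And>x. x \<in> B \<Longrightarrow> norm x = 1"
    "independent B" "card B = dim (span S)" "span B = span S"
    using orthonormal_basis_subspace[OF subspace_span[of S]] by metis
  have "orthonormal_set B"
    using B(1,2,3) independent_imp_finite[OF B(3)]
    by (auto simp: orthonormal_set_def pairwise_def orthogonal_def norm_eq_1)
  then show ?thesis using that B by simp
qed

lemma proj_0 [simp]: "proj B 0 = 0"
  by (simp add: proj_def)

lemma proj_add: "proj B (x + y) = proj B x + proj B y"
  by (simp add: proj_def inner_add_right scaleR_add_left sum.distrib)

lemma proj_diff: "proj B (x - y) = proj B x - proj B y"
  by (simp add: proj_def inner_diff_right scaleR_diff_left sum_subtractf)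

lemma linear_proj: "linear (proj B)"
  by (rule linearI) (simp_all add: proj_add, simp add: proj_def scaleR_sum_right)

lemma inner_proj: "proj B x \<bullet> y = (\<Sum>b\<in>B. (b \<bullet> x) * (b \<bullet> y))"
  by (simp add: proj_def inner_sum_left)

lemma inner_proj_commute: "x \<bullet> proj B y = proj B x \<bullet> y"
  by (simp add: inner_proj inner_commute[of x] mult.commute)

lemma proj_basis: "orthonormal_set B \<Longrightarrow> b \<in> B \<Longrightarrow> proj B b = b"
  by (simp add: proj_def orthonormal_set_def if_distrib[of "\<lambda>c. c *\<^sub>R _"] sum.delta cong: if_cong)

lemma proj_span:
  assumes "orthonormal_set B" "x \<in> span B"
  shows "proj B x = x"
  using assms(2)
proof (induction rule: span_induct)
  case base
  show ?case by (auto intro!: subspaceI simp: proj_add linear_cmul[OF linear_proj])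
next
  case (step x)
  then show ?case by (rule proj_basis[OF assms(1)])
qed

lemma proj_in_span: "proj B x \<in> span B"
  unfolding proj_def by (intro span_sum span_scale span_base)

lemma proj_proj: "orthonormal_set B \<Longrightarrow> proj B (proj B x) = proj B x"
  by (simp add: proj_span proj_in_span)

text \<open>The elementary factor of degree one of a paraunitary matrix: the component in \<open>span B\<close> stays
  in place, the component orthogonal to it moves one step to the left.\<close>
definition partial_shift :: "(real ^ 'n) set \<Rightarrow> 'n::finite vseq \<Rightarrow> 'n vseq" where
  "partial_shift B s = (\<lambda>k. proj B (s k) + (s (k + 1) - proj B (s (k + 1))))"

lemma finsupp_shift: "finsupp s \<Longrightarrow> finsupp (\<lambda>k. s (k + c))"
  by (rule finsupp_reindex[of s "\<lambda>k. k + c"]) (auto simp: inj_def)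

lemma finsupp_partial_shift: "finsupp s \<Longrightarrow> finsupp (partial_shift B s)"
  by (rule finsupp_union[of s, OF _ finsupp_shift[of s 1]]) (auto simp: partial_shift_def)

lemma inner_partial_shift:
  assumes "orthonormal_set B"
  shows "(proj B x + (x' - proj B x')) \<bullet> (proj B y + (y' - proj B y'))
       = proj B x \<bullet> y + (x' \<bullet> y' - proj B x' \<bullet> y')"
  by (simp add: inner_add_left inner_add_right inner_diff_left inner_diff_right
      inner_proj_commute proj_add proj_diff proj_proj[OF assms])

lemma l2_inner_partial_shift:
  assumes B: "orthonormal_set B" and s: "finsupp s"
  shows "l2_inner (partial_shift B s) (partial_shift B t) = l2_inner s t"
proof -
  have "l2_inner (partial_shift B s) (partial_shift B t)
      = (\<Sum>\<^sub>\<infinity>k. proj B (s k) \<bullet> t k + (s (k + 1) \<bullet> t (k + 1) - proj B (s (k + 1)) \<bullet> t (k + 1)))"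
    by (simp add: l2_inner_def partial_shift_def inner_partial_shift[OF B])
  also have "\<dots> = (\<Sum>\<^sub>\<infinity>k. proj B (s k) \<bullet> t k)
      + (\<Sum>\<^sub>\<infinity>k. s (k + 1) \<bullet> t (k + 1) - proj B (s (k + 1)) \<bullet> t (k + 1))"
    by (rule infsum_add, rule summable_on_finsupp[OF s], simp,
        rule summable_on_finsupp[OF finsupp_shift[OF s, of 1]], simp)
  also have "\<dots> = (\<Sum>\<^sub>\<infinity>k. proj B (s k) \<bullet> t k) + (\<Sum>\<^sub>\<infinity>k. s k \<bullet> t k - proj B (s k) \<bullet> t k)"
    using infsum_shift[of "\<lambda>k. s k \<bullet> t k - proj B (s k) \<bullet> t k" 1] by simp
  also have "\<dots> = (\<Sum>\<^sub>\<infinity>k. proj B (s k) \<bullet> t k + (s k \<bullet> t k - proj B (s k) \<bullet> t k))"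
    by (rule infsum_add[symmetric]; rule summable_on_finsupp[OF s]; simp)
  finally show ?thesis by (simp add: l2_inner_def)
qed

lemma shift_isometry_partial_shift:
  assumes B: "orthonormal_set B"
  shows "shift_isometry 1 1 (partial_shift B)"
  unfolding shift_isometry_def
proof (intro conjI allI impI)
  fix v :: "'a vseq" assume v: "finsupp v"
  let ?s = "\<lambda>k. proj B (v k) + (v (k - 1) - proj B (v (k - 1)))"
  have "finsupp ?s"
    using finsupp_shift[OF v, of "-1"] by (auto intro: finsupp_union[OF v])
  moreover have "partial_shift B ?s = v"
    by (simp add: partial_shift_def proj_add proj_diff proj_proj[OF B])
  ultimately show "\<exists>s. finsupp s \<and> partial_shift B s = v" by blast
next
  fix s m show "partial_shift B (translate (1 * m) s) = translate (1 * m) (partial_shift B s)"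
    by (simp add: partial_shift_def translate_def algebra_simps)
qed (simp_all add: l2_inner_partial_shift[OF B] finsupp_partial_shift)

text \<open>The moment drops by the energy of the part that moves, since this part moves by one step.\<close>
lemma moment_partial_shift:
  assumes B: "orthonormal_set B" and s: "finsupp s"
  shows "moment (partial_shift B s)
       = moment s - ((\<Sum>\<^sub>\<infinity>k. (norm (s k))\<^sup>2) - (\<Sum>\<^sub>\<infinity>k. \<Sum>b\<in>B. (b \<bullet> s k)\<^sup>2))"
proof -
  let ?p = "\<lambda>k. \<Sum>b\<in>B. (b \<bullet> s k)\<^sup>2" and ?n = "\<lambda>k. (norm (s k))\<^sup>2"
  have ps: "(norm (partial_shift B s k))\<^sup>2 = ?p k + (?n (k + 1) - ?p (k + 1))" for k
    unfolding power2_norm_eq_inner partial_shift_def inner_partial_shift[OF B]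
    by (simp add: inner_proj power2_eq_square)
  have "moment (partial_shift B s)
      = (\<Sum>\<^sub>\<infinity>k. of_int k * ?p k + of_int k * (?n (k + 1) - ?p (k + 1)))"
    by (simp add: moment_def ps algebra_simps)
  also have "\<dots> = (\<Sum>\<^sub>\<infinity>k. of_int k * ?p k) + (\<Sum>\<^sub>\<infinity>k. of_int k * (?n (k + 1) - ?p (k + 1)))"
    by (rule infsum_add, rule summable_on_finsupp[OF s], simp,
        rule summable_on_finsupp[OF finsupp_shift[OF s, of 1]], simp)
  also have "(\<Sum>\<^sub>\<infinity>k. of_int k * (?n (k + 1) - ?p (k + 1))) = (\<Sum>\<^sub>\<infinity>k. of_int (k - 1) * (?n k - ?p k))"
    using infsum_shift[of "\<lambda>k. of_int (k - 1) * (?n k - ?p k)" 1] by simp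
  also have "(\<Sum>\<^sub>\<infinity>k. of_int k * ?p k) + \<dots> = (\<Sum>\<^sub>\<infinity>k. of_int k * ?p k + of_int (k - 1) * (?n k - ?p k))"
    by (rule infsum_add[symmetric]; rule summable_on_finsupp[OF s]; simp)
  also have "\<dots> = (\<Sum>\<^sub>\<infinity>k. of_int k * ?n k - (?n k - ?p k))"
    by (rule infsum_cong) (simp add: algebra_simps)
  also have "\<dots> = moment s - (\<Sum>\<^sub>\<infinity>k. ?n k - ?p k)"
    unfolding moment_def by (rule infsum_diff; rule summable_on_finsupp[OF s]; simp)
  also have "(\<Sum>\<^sub>\<infinity>k. ?n k - ?p k) = (\<Sum>\<^sub>\<infinity>k. ?n k) - (\<Sum>\<^sub>\<infinity>k. ?p k)"
    by (rule infsum_diff; rule summable_on_finsupp[OF s]; simp)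
  finally show ?thesis .
qed

section \<open>Moment bounds at the ends of the support\<close>

text \<open>A large first space forces the centre of mass to the left. Let \<open>V\<close> be the span of the first values.
  The last values are orthogonal to \<open>V\<close>, so shifting the part orthogonal to \<open>V\<close> to the left by one
  step removes the last position without creating a new first one. Each such shift lowers the
  total moment by the codimension of \<open>V\<close>, and the space of first values can only grow, because its
  projection to \<open>V\<close> still is \<open>V\<close>. After \<open>N\<close> shifts nothing is left to the right of 0.\<close>
lemma moment_le_codim_first:
  fixes h :: "'j::finite \<Rightarrow> 'n::finite vseq"
  assumes "orthonormal_translates 1 h" "parseval_translates 1 h"
    and "\<And>j k. k \<notin> {0..int N} \<Longrightarrow> h j k = 0"
  shows "(\<Sum>j\<in>UNIV. moment (h j)) \<le> real N * (real CARD('n) - real (dim (range (\<lambda>j. h j 0))))"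
  using assms
proof (induction N arbitrary: h)
  case 0
  have "of_int k * (norm (h j k))\<^sup>2 = 0" for j k
    using "0.prems"(3)[of k j] by (cases "k = 0") auto
  then have "moment (h j) = 0" for j
    unfolding moment_def by (rule infsum_0)
  then show ?case by simp
next
  case (Suc N)
  have fin: "finsupp (h j)" for j
    by (rule finsupp_interval[OF Suc.prems(3)])
  obtain B where B: "orthonormal_set B" and card: "card B = dim (range (\<lambda>j. h j 0))"
    and span: "span B = span (range (\<lambda>j. h j 0))"
    by (rule orthonormal_basis_of_span)
  \<comment> \<open>The shift moves nothing out of position 0 and leaves nothing at position \<open>Suc N\<close>.\<close>
  have first: "proj B (h j 0) = h j 0" for j
    by (rule proj_span[OF B]) (simp add: span span_base)
  have last: "proj B (h j (int (Suc N))) = 0" for j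
  proof -
    have "b \<bullet> h j (int (Suc N)) = 0" if "b \<in> B" for b
    proof -
      have "b \<in> span (range (\<lambda>j. h j 0))" using that span span_base by blast
      then have "orthogonal (h j (int (Suc N))) b"
        by (rule orthogonal_to_span)
           (use orthonormal_ends_orthogonal[OF Suc.prems(1,3)] in \<open>auto simp: orthogonal_def inner_commute\<close>)
      then show ?thesis by (simp add: orthogonal_def inner_commute)
    qed
    then show ?thesis by (simp add: proj_def)
  qed
  let ?g = "\<lambda>j. partial_shift B (h j)"
  have g: "orthonormal_translates 1 ?g" "parseval_translates 1 ?g"
    using orthonormal_translates_image[OF shift_isometry_partial_shift[OF B] fin Suc.prems(1)]
      parseval_translates_image[OF shift_isometry_partial_shift[OF B] fin Suc.prems(2)] .
  have supp: "?g j k = 0" if k: "k \<notin> {0..int N}" for j k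
  proof -
    have "k \<notin> {0..int (Suc N)} \<or> k = int (Suc N)" "k + 1 \<notin> {0..int (Suc N)} \<or> k + 1 = 0"
      using k by auto
    then show ?thesis
      using Suc.prems(3)[of k j] Suc.prems(3)[of "k + 1" j] first[of j] last[of j]
      unfolding partial_shift_def by fastforce
  qed
  have "range (\<lambda>j. h j 0) = proj B ` range (\<lambda>j. ?g j 0)"
    by (simp add: image_image partial_shift_def proj_add proj_diff proj_proj[OF B] first)
  then have dim: "dim (range (\<lambda>j. h j 0)) \<le> dim (range (\<lambda>j. ?g j 0))"
    using dim_image_le[OF linear_proj] by metis
  have "(\<Sum>j\<in>UNIV. moment (?g j)) = (\<Sum>j\<in>UNIV. moment (h j)) - (real CARD('n) - real (card B))"
    using parseval_total_energy[OF Suc.prems(2) fin] parseval_subspace_energy[OF Suc.prems(2) fin, of B] B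
    unfolding moment_partial_shift[OF B fin] sum_subtractf orthonormal_set_def by simp
  moreover have "(\<Sum>j\<in>UNIV. moment (?g j)) \<le> real N * (real CARD('n) - real (dim (range (\<lambda>j. ?g j 0))))"
    by (rule Suc.IH[OF g supp])
  moreover have "\<dots> \<le> real N * (real CARD('n) - real (dim (range (\<lambda>j. h j 0))))"
    using dim by (intro mult_left_mono) auto
  ultimately show ?case by (simp add: card algebra_simps)
qed

definition reflect :: "'n::finite vseq \<Rightarrow> 'n vseq" where
  "reflect s = (\<lambda>k. s (- k))"

lemma finsupp_reflect: "finsupp s \<Longrightarrow> finsupp (reflect s)"
  by (rule finsupp_reindex[of s uminus]) (auto simp: reflect_def)

lemma shift_isometry_reflect: "shift_isometry 1 (-1) reflect"
  unfolding shift_isometry_def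
proof (intro conjI allI impI)
  fix s u :: "'a vseq"
  show "l2_inner (reflect s) (reflect u) = l2_inner s u"
    unfolding l2_inner_def reflect_def by (rule infsum_uminus_arg)
next
  fix v :: "'a vseq" assume "finsupp v"
  moreover have "reflect (reflect v) = v" by (simp add: reflect_def)
  ultimately show "\<exists>s. finsupp s \<and> reflect s = v" using finsupp_reflect by blast
next
  fix s :: "'a vseq" and m :: int
  have "- k - m = - m - k" for k :: int by simp
  then show "reflect (translate (1 * m) s) = translate (- 1 * m) (reflect s)"
    by (simp add: reflect_def translate_def)
qed (simp add: finsupp_reflect)

lemma orthonormal_translates_uminus:
  "orthonormal_translates (- t) h \<longleftrightarrow> orthonormal_translates t h"
  unfolding orthonormal_translates_def
  by (metis minus_mult_commute neg_equal_0_iff_equal minus_minus)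

lemma parseval_translates_uminus:
  "parseval_translates (- t) h \<longleftrightarrow> parseval_translates t h"
  unfolding parseval_translates_def
  using infsum_uminus_arg[of "\<lambda>m. (l2_inner _ (translate (t * m) (h _)))\<^sup>2"] by simp

lemma shift_isometry_translate: "shift_isometry t t (translate c)"
  unfolding shift_isometry_def
proof (intro conjI allI impI)
  fix v :: "'a vseq" assume "finsupp v"
  moreover have "translate c (translate (- c) v) = v" by (simp add: translate_def)
  ultimately show "\<exists>s. finsupp s \<and> translate c s = v" using finsupp_translate by blast
qed (simp_all add: finsupp_translate l2_inner_translate, simp add: translate_def algebra_simps)

text \<open>The mirror image of \<open>moment_le_codim_first\<close>, applied to \<open>\<lambda>k. h j (N - k)\<close>.\<close>
lemma moment_ge_dim_last:
  fixes h :: "'j::finite \<Rightarrow> 'n::finite vseq"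
  assumes h: "orthonormal_translates 1 h" "parseval_translates 1 h"
    and supp: "\<And>j k. k \<notin> {0..int N} \<Longrightarrow> h j k = 0"
  shows "real N * real (dim (range (\<lambda>j. h j (int N)))) \<le> (\<Sum>j\<in>UNIV. moment (h j))"
proof -
  have fin: "finsupp (h j)" for j
    by (rule finsupp_interval[OF supp])
  let ?r = "\<lambda>j. reflect (h j)"
  let ?g = "\<lambda>j. translate (int N) (?r j)"
  have r: "orthonormal_translates 1 ?r" "parseval_translates 1 ?r"
    using orthonormal_translates_image[OF shift_isometry_reflect fin h(1)]
      parseval_translates_image[OF shift_isometry_reflect fin h(2)]
    by (simp_all add: orthonormal_translates_uminus parseval_translates_uminus)
  have g: "orthonormal_translates 1 ?g" "parseval_translates 1 ?g"
    using orthonormal_translates_image[OF shift_isometry_translate finsupp_reflect[OF fin] r(1)]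
      parseval_translates_image[OF shift_isometry_translate finsupp_reflect[OF fin] r(2)] .
  have val: "?g j k = h j (int N - k)" for j k
    by (simp add: reflect_def translate_def)
  have "?g j k = 0" if "k \<notin> {0..int N}" for j k
    unfolding val using that by (intro supp) auto
  then have "(\<Sum>j\<in>UNIV. moment (?g j)) \<le> real N * (real CARD('n) - real (dim (range (\<lambda>j. h j (int N)))))"
    using moment_le_codim_first[OF g, of N] by (simp add: val)
  moreover have "moment (?g j) = real N * (\<Sum>\<^sub>\<infinity>k. (norm (h j k))\<^sup>2) - moment (h j)" for j
  proof -
    have "moment (?g j) = (\<Sum>\<^sub>\<infinity>k. of_int (int N - k) * (norm (h j k))\<^sup>2)"
      unfolding moment_def val
      using infsum_shift[of "\<lambda>k. of_int (- k) * (norm (h j (int N + k)))\<^sup>2" 0]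
        infsum_uminus_arg[of "\<lambda>k. of_int k * (norm (h j (int N - k)))\<^sup>2"]
        infsum_shift[of "\<lambda>k. of_int (int N - k) * (norm (h j k))\<^sup>2" "int N"]
      by (simp add: add.commute)
    also have "\<dots> = (\<Sum>\<^sub>\<infinity>k. real N * (norm (h j k))\<^sup>2 - of_int k * (norm (h j k))\<^sup>2)"
      by (simp add: algebra_simps)
    also have "\<dots> = (\<Sum>\<^sub>\<infinity>k. real N * (norm (h j k))\<^sup>2) - (\<Sum>\<^sub>\<infinity>k. of_int k * (norm (h j k))\<^sup>2)"
      by (rule infsum_diff; rule summable_on_finsupp[OF fin[of j]]; simp)
    finally show ?thesis by (simp add: infsum_cmult_right' moment_def)
  qed
  ultimately show ?thesis
    using parseval_total_energy[OF h(2) fin]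
    by (simp add: sum_subtractf sum_distrib_left[symmetric] algebra_simps)
qed

section \<open>Block rotations and the first moment\<close>

definition rotate_blocks :: "nat \<Rightarrow> real ^ ('d + 'd) ^ ('d + 'd) \<Rightarrow> 'd::finite vseq \<Rightarrow> 'd vseq" where
  "rotate_blocks e M s = (if e = 0 then U0 M s else U1 M s)"

lemma block_vec_U0: "even m \<Longrightarrow> block_vec (U0 M s) m = M *v block_vec s m"
proof -
  assume m: "even m"
  have "block_vec (U0 M s) m $ j = (M *v block_vec s m) $ j" for j
    using m by (cases j) (simp_all add: block_vec_def[of "U0 M s"], simp_all add: U0_def)
  then show ?thesis by (simp add: vec_eq_iff)
qed

lemma block_vec_rotate:
  assumes "e \<in> {0, 1}" "even (m - int e)"
  shows "block_vec (rotate_blocks e M s) m = M *v block_vec s m"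
  using assms by (auto simp: rotate_blocks_def block_vec_U0 U1_def block_vec_translate)

lemma blocks_rotate:
  "e \<in> {0, 1} \<Longrightarrow> blocks (int e) (rotate_blocks e M s) = (\<lambda>n. M *v blocks (int e) s n)"
  unfolding blocks_def by (rule ext, rule block_vec_rotate) auto

lemma rotate_blocks_transpose:
  assumes "e \<in> {0, 1}" "orthogonal_matrix M"
  shows "rotate_blocks e (transpose M) (rotate_blocks e M s) = s"
  by (rule blocks_eqD[of "int e"])
     (use assms in \<open>simp add: blocks_rotate matrix_vector_mul_assoc orthogonal_matrix_def\<close>)

lemma inner_orthogonal_matrix:
  fixes M :: "real ^ 'n ^ 'n"
  assumes "orthogonal_matrix M"
  shows "(M *v x) \<bullet> (M *v y) = x \<bullet> y"
  using assms orthogonal_transformation_matrix[of "(*v) M"]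
  by (simp add: orthogonal_transformation_def matrix_vector_mul_linear)

lemma finsupp_rotate:
  assumes "e \<in> {0, 1}" "finsupp s"
  shows "finsupp (rotate_blocks e M s)"
proof -
  have "finsupp (\<lambda>n. M *v blocks (int e) s n)"
    by (rule finsupp_reindex[of "blocks (int e) s" "\<lambda>n. n"]) (auto intro: finsupp_blocks assms(2))
  then have "finsupp (blocks (int e) (rotate_blocks e M s))"
    unfolding blocks_rotate[OF assms(1)] .
  from finsupp_unblocks[OF this, of "int e"] show ?thesis
    unfolding unblocks_blocks .
qed

lemma shift_isometry_rotate:
  assumes e: "e \<in> {0, 1}" and M: "orthogonal_matrix M"
  shows "shift_isometry 2 2 (rotate_blocks e M)"
  unfolding shift_isometry_def
proof (intro conjI allI impI)
  fix s u :: "'a vseq" assume "finsupp s" "finsupp u"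
  have "l2_inner (rotate_blocks e M s) (rotate_blocks e M u)
      = l2_inner (blocks (int e) (rotate_blocks e M s)) (blocks (int e) (rotate_blocks e M u))"
    by (rule l2_inner_blocks[symmetric]) (rule finsupp_rotate[OF e \<open>finsupp s\<close>])
  also have "\<dots> = l2_inner (blocks (int e) s) (blocks (int e) u)"
    by (simp add: blocks_rotate[OF e] l2_inner_def inner_orthogonal_matrix[OF M])
  finally show "l2_inner (rotate_blocks e M s) (rotate_blocks e M u) = l2_inner s u"
    by (simp add: l2_inner_blocks[OF \<open>finsupp s\<close>])
next
  fix s m show "rotate_blocks e M (translate (2 * m) s) = translate (2 * m) (rotate_blocks e M s)"
    by (rule blocks_eqD[of "int e"])
       (simp add: blocks_rotate[OF e] blocks_translate, simp add: translate_def)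
next
  fix v :: "'a vseq" assume v: "finsupp v"
  have "rotate_blocks e (transpose (transpose M)) (rotate_blocks e (transpose M) v) = v"
    by (rule rotate_blocks_transpose[OF e]) (simp add: M)
  then show "\<exists>s. finsupp s \<and> rotate_blocks e M s = v"
    using finsupp_rotate[OF e v] by auto
qed (rule finsupp_rotate[OF e])

definition trivial_system :: "'d + 'd \<Rightarrow> 'd::finite vseq" where
  "trivial_system = case_sum (\<lambda>l. unit_seq l 0) (\<lambda>l. unit_seq l 1)"

lemma blocks_trivial: "blocks 0 (trivial_system j) n = (if n = 0 then axis j 1 else 0)"
proof -
  have "2 * n \<noteq> 1" "2 * n + 1 = 1 \<longleftrightarrow> n = 0" "2 * n + 1 \<noteq> 0" by presburger+
  then have "blocks 0 (trivial_system j) n $ i = (if n = 0 then axis j 1 else 0) $ i" for i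
    by (cases i; cases j)
       (simp_all add: blocks_def block_vec_def trivial_system_def unit_seq_def axis_def)
  then show ?thesis by (simp add: vec_eq_iff)
qed

lemma finsupp_trivial: "finsupp (trivial_system j)"
  by (rule finsupp_interval[of 0 1]) (auto simp: trivial_system_def unit_seq_def split: sum.split)

text \<open>In blocks of the even covering, the trivial system and its even translates are the canonical
  basis sequences, so inner products with them are coordinates.\<close>
lemma inner_translate_trivial:
  assumes "finsupp v"
  shows "l2_inner v (translate (2 * m) (trivial_system j)) = blocks 0 v m $ j"
proof -
  have "l2_inner v (translate (2 * m) (trivial_system j))
      = l2_inner (blocks 0 v) (translate m (blocks 0 (trivial_system j)))"
    by (simp add: l2_inner_blocks[OF assms] flip: blocks_translate)
  also have "\<dots> = blocks 0 v m \<bullet> translate m (blocks 0 (trivial_system j)) m"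
    by (rule l2_inner_single) (simp add: translate_def blocks_trivial)
  finally show ?thesis by (simp add: translate_def blocks_trivial inner_axis)
qed

lemma orthonormal_trivial: "orthonormal_translates 2 trivial_system"
  unfolding orthonormal_translates_def
  by (simp add: inner_translate_trivial finsupp_trivial blocks_trivial, simp add: axis_def)

lemma parseval_trivial: "parseval_translates 2 (trivial_system :: 'd::finite + 'd \<Rightarrow> 'd vseq)"
  unfolding parseval_translates_def
proof (intro allI impI)
  fix v :: "'d vseq" assume v: "finsupp v"
  have "(\<Sum>j\<in>UNIV. \<Sum>\<^sub>\<infinity>m. (l2_inner v (translate (2 * m) (trivial_system j)))\<^sup>2)
      = (\<Sum>j\<in>UNIV. \<Sum>\<^sub>\<infinity>m. (blocks 0 v m $ j)\<^sup>2)"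
    by (simp add: inner_translate_trivial[OF v])
  also have "\<dots> = (\<Sum>\<^sub>\<infinity>m. \<Sum>j\<in>UNIV. (blocks 0 v m $ j)\<^sup>2)"
    by (rule infsum_finite_sum[symmetric], simp,
        rule summable_on_finsupp[OF finsupp_blocks[OF v, of 0]], simp)
  also have "\<dots> = l2_inner (blocks 0 v) (blocks 0 v)"
    by (simp add: l2_inner_def inner_vec_def power2_eq_square)
  also have "\<dots> = l2_inner v v"
    by (rule l2_inner_blocks[OF v])
  finally show "(\<Sum>j\<in>UNIV. \<Sum>\<^sub>\<infinity>m. (l2_inner v (translate (2 * m) (trivial_system j)))\<^sup>2) = l2_inner v v" .
qed

lemma orthonormal_translates_norm:
  assumes "orthonormal_translates t h"
  shows "l2_inner (h j) (h j) = 1"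
  using assms[unfolded orthonormal_translates_def, rule_format, of j 0 j]
  by (simp add: translate_def)

text \<open>The total moment determines the total block moment of either covering: by completeness the
  family has energy \<open>CARD('d)\<close> on the positions of each parity, and by orthonormality it has total
  energy \<open>2 * CARD('d)\<close>, whatever the family.\<close>
lemma total_moment_blocks:
  fixes f :: "'d::finite + 'd \<Rightarrow> 'd vseq"
  assumes f: "\<And>j. finsupp (f j)" "orthonormal_translates 2 f" "parseval_translates 2 f"
  shows "(\<Sum>j\<in>UNIV. moment (f j))
       = 2 * (\<Sum>j\<in>UNIV. moment (blocks p (f j))) + (2 * of_int p + 1) * real CARD('d)"
proof -
  let ?h = "\<lambda>j. blocks p (f j)"
  \<comment> \<open>The second position of each block.\<close>
  let ?B = "range (\<lambda>i::'d. axis (Inr i) 1 :: real ^ ('d + 'd))"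
  have inj: "inj (\<lambda>i::'d. axis (Inr i) 1 :: real ^ ('d + 'd))"
    by (auto simp: inj_def axis_eq_axis)
  have h: "parseval_translates 1 ?h" "\<And>j. finsupp (?h j)"
    using parseval_translates_image[OF shift_isometry_blocks f(1,3)] finsupp_blocks[OF f(1)] by auto
  have "(\<Sum>b\<in>?B. (b \<bullet> ?h j n)\<^sup>2) = (norm (f j (2 * n + p + 1)))\<^sup>2" for j n
    by (simp add: sum.reindex[OF inj] inner_axis' blocks_def block_vec_def power2_norm_eq_inner)
       (simp add: inner_vec_def power2_eq_square)
  moreover have "card ?B = CARD('d)"
    by (rule card_image[OF inj])
  moreover have "b \<bullet> b = 1" if "b \<in> ?B" for b
    using that by (auto simp: inner_axis)
  ultimately have "(\<Sum>j\<in>UNIV. \<Sum>\<^sub>\<infinity>n. (norm (f j (2 * n + p + 1)))\<^sup>2) = real CARD('d)"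
    using parseval_subspace_energy[OF h, of ?B] by simp
  then show ?thesis
    by (simp add: moment_blocks[OF f(1), of _ p] orthonormal_translates_norm[OF f(2)] sum.distrib
        sum_distrib_left algebra_simps)
qed

lemma total_moment_trivial:
  "(\<Sum>j\<in>UNIV. moment (trivial_system j :: 'd::finite vseq)) = real CARD('d)"
proof -
  have "of_int k * (norm (blocks 0 (trivial_system j :: 'd vseq) k))\<^sup>2 = 0" for k j
    by (simp add: blocks_trivial)
  then have "moment (blocks 0 (trivial_system j :: 'd vseq)) = 0" for j
    unfolding moment_def by (rule infsum_0)
  then show ?thesis
    by (simp add: total_moment_blocks[OF finsupp_trivial orthonormal_trivial parseval_trivial, of 0])
qed

text \<open>A rotation preserves the norm of each block of its own covering, hence the block moments with
  respect to that covering, and these determine the total moment.\<close>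
lemma total_moment_rotate:
  fixes f :: "'d::finite + 'd \<Rightarrow> 'd vseq"
  assumes f: "\<And>j. finsupp (f j)" "orthonormal_translates 2 f" "parseval_translates 2 f"
    and e: "e \<in> {0, 1}" and M: "orthogonal_matrix M"
  shows "(\<Sum>j\<in>UNIV. moment (rotate_blocks e M (f j))) = (\<Sum>j\<in>UNIV. moment (f j))"
proof -
  note iso = shift_isometry_rotate[OF e M]
  have "moment (blocks (int e) (rotate_blocks e M (f j))) = moment (blocks (int e) (f j))" for j
    by (simp add: moment_def blocks_rotate[OF e] power2_norm_eq_inner inner_orthogonal_matrix[OF M])
  then show ?thesis
    by (simp add: total_moment_blocks[OF f, of "int e"]
        total_moment_blocks[OF finsupp_rotate[OF e f(1)] orthonormal_translates_image[OF iso f(1,2)]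
          parseval_translates_image[OF iso f(1,3)], of "int e"])
qed

text \<open>Obtainability for the \<open>2d\<close> sequences taken as one family, which is the form that the results on
  families of translates need.\<close>
definition reachable :: "('d::finite + 'd \<Rightarrow> 'd vseq) \<Rightarrow> bool" where
  "reachable f \<longleftrightarrow>
     (\<exists>K e M. (\<forall>k<K. e k \<in> {0, 1} \<and> orthogonal_matrix (M k)) \<and>
        (\<forall>j. f j = U_prod e M K (trivial_system j)))"

lemma obtainable_iff_reachable: "obtainable a b \<longleftrightarrow> reachable (case_sum a b)"
  unfolding obtainable_def reachable_def trivial_system_def
  by (simp add: split_sum_all all_conj_distrib)

lemma U_prod_Suc: "U_prod e M (Suc k) s = rotate_blocks (e k) (M k) (U_prod e M k s)"
  by (simp add: rotate_blocks_def)

lemma U_prod_cong: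
  "(\<And>k. k < K \<Longrightarrow> e k = e' k \<and> M k = M' k) \<Longrightarrow> U_prod e M K s = U_prod e' M' K s"
  by (induction K) simp_all

lemma reachable_rotate:
  assumes "reachable f" "e \<in> {0, 1}" "orthogonal_matrix M"
  shows "reachable (\<lambda>j. rotate_blocks e M (f j))"
proof -
  obtain K e' M' where K: "\<forall>k<K. e' k \<in> {0, 1} \<and> orthogonal_matrix (M' k)"
    "\<forall>j. f j = U_prod e' M' K (trivial_system j)"
    using assms(1) unfolding reachable_def by blast
  let ?e = "e'(K := e)" and ?M = "M'(K := M)"
  have "U_prod ?e ?M K s = U_prod e' M' K s" for s
    by (rule U_prod_cong) auto
  then have "rotate_blocks e M (f j) = U_prod ?e ?M (Suc K) (trivial_system j)" for j
    using K(2) unfolding U_prod_Suc by simp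
  moreover have "\<forall>k<Suc K. ?e k \<in> {0, 1} \<and> orthogonal_matrix (?M k)"
    using K(1) assms(2,3) by (auto simp: less_Suc_eq)
  ultimately show ?thesis unfolding reachable_def by blast
qed

lemma reachable_invariants:
  fixes f :: "'d::finite + 'd \<Rightarrow> 'd vseq"
  assumes "reachable f"
  shows "\<And>j. finsupp (f j)" "orthonormal_translates 2 f" "parseval_translates 2 f"
    "(\<Sum>j\<in>UNIV. moment (f j)) = real CARD('d)"
proof -
  obtain K e M where K: "\<forall>k<K. e k \<in> {0, 1} \<and> orthogonal_matrix (M k)"
    and "\<forall>j. f j = U_prod e M K (trivial_system j)"
    using assms unfolding reachable_def by blast
  then have f: "f = (\<lambda>j. U_prod e M K (trivial_system j))" by blast
  let ?f = "\<lambda>K j. U_prod e M K (trivial_system j)"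
  have "(\<forall>j. finsupp (?f K j)) \<and> orthonormal_translates 2 (?f K) \<and> parseval_translates 2 (?f K)
      \<and> (\<Sum>j\<in>UNIV. moment (?f K j)) = real CARD('d)"
    using K
  proof (induction K)
    case 0
    show ?case
      by (simp add: finsupp_trivial orthonormal_trivial parseval_trivial total_moment_trivial)
  next
    case (Suc K)
    then have e: "e K \<in> {0, 1}" and M: "orthogonal_matrix (M K)"
      and IH: "\<And>j. finsupp (?f K j)" "orthonormal_translates 2 (?f K)" "parseval_translates 2 (?f K)"
        "(\<Sum>j\<in>UNIV. moment (?f K j)) = real CARD('d)"
      by auto
    note iso = shift_isometry_rotate[OF e M]
    show ?case
      unfolding U_prod_Suc
      using finsupp_rotate[OF e IH(1)] orthonormal_translates_image[OF iso IH(1,2)]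
        parseval_translates_image[OF iso IH(1,3)] total_moment_rotate[OF IH(1-3) e M] IH(4)
      by simp
  qed
  then show "\<And>j. finsupp (f j)" "orthonormal_translates 2 f" "parseval_translates 2 f"
    "(\<Sum>j\<in>UNIV. moment (f j)) = real CARD('d)"
    by (simp_all add: f)
qed

section \<open>Outermost blocks of obtainable systems\<close>

lemma dim_half_block:
  fixes f :: "'j \<Rightarrow> 'd::finite vseq"
  assumes "(\<forall>j. f j m = 0) \<or> (\<forall>j. f j (m + 1) = 0)"
  shows "dim (range (\<lambda>j. block_vec (f j) m)) \<le> CARD('d)"
proof -
  have dim: "dim (range (\<lambda>j. block_vec (f j) m)) \<le> CARD('d)"
    if "\<And>j. block_vec (f j) m = (\<Sum>i\<in>UNIV. c j i *\<^sub>R axis (g i) 1)" for c and g :: "'d \<Rightarrow> 'd + 'd"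
  proof -
    let ?A = "range (\<lambda>i::'d. axis (g i) 1 :: real ^ ('d + 'd))"
    have "range (\<lambda>j. block_vec (f j) m) \<subseteq> span ?A"
      unfolding that by (intro image_subsetI span_sum span_scale span_base) auto
    then have "dim (range (\<lambda>j. block_vec (f j) m)) \<le> card ?A"
      by (rule dim_le_card) simp
    also have "\<dots> \<le> CARD('d)" by (rule card_image_le) simp
    finally show ?thesis .
  qed
  show ?thesis
  proof (cases "\<forall>j. f j m = 0")
    case True
    have "block_vec (f j) m $ k = (\<Sum>i\<in>UNIV. f j (m + 1) $ i *\<^sub>R axis (Inr i) 1) $ k" for j k
      using True by (cases k) (simp_all add: block_vec_def axis_def if_distrib sum.delta cong: if_cong)
    then show ?thesis
      by (intro dim[of "\<lambda>j i. f j (m + 1) $ i" Inr]) (simp add: vec_eq_iff)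
  next
    case False
    then have z: "\<forall>j. f j (m + 1) = 0" using assms by blast
    have "block_vec (f j) m $ k = (\<Sum>i\<in>UNIV. f j m $ i *\<^sub>R axis (Inl i) 1) $ k" for j k
      using z by (cases k) (simp_all add: block_vec_def axis_def if_distrib sum.delta cong: if_cong)
    then show ?thesis
      by (intro dim[of "\<lambda>j i. f j m $ i" Inl]) (simp add: vec_eq_iff)
  qed
qed

lemma block_outside:
  assumes "\<And>k. k \<notin> {p..q + 1} \<Longrightarrow> s k = 0" "q = p + 2 * int N" "n \<notin> {0..int N}"
  shows "blocks p s n = 0"
  unfolding blocks_def block_vec_eq_0_iff using assms by auto

text \<open>The total moment \<open>CARD('d)\<close> of energy \<open>2 * CARD('d)\<close> puts the centre of mass at \<open>1 / 2\<close>. If the first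
  block \<open>{p, p + 1}\<close> has dimension above \<open>CARD('d)\<close>, the moment bound puts the centre of mass to the left
  of the middle of \<open>{p..q + 1}\<close>, so \<open>p + q > 0\<close>. If the last block \<open>{q - 1, q}\<close> of the opposite
  covering is too large as well, the centre lies to the right of the middle of \<open>{p - 1..q}\<close>, so
  \<open>p + q < 2\<close>. But \<open>p + q\<close> is even.\<close>
lemma moment_forces_small_end:
  fixes f :: "'d::finite + 'd \<Rightarrow> 'd vseq"
  assumes f: "\<And>j. finsupp (f j)" "orthonormal_translates 2 f" "parseval_translates 2 f"
    "(\<Sum>j\<in>UNIV. moment (f j)) = real CARD('d)"
    and supp: "\<And>j k. k \<notin> {p..q} \<Longrightarrow> f j k = 0" and q: "q = p + 2 * int N" and N: "N > 0"
  shows "dim (range (\<lambda>j. block_vec (f j) p)) \<le> CARD('d)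
       \<or> dim (range (\<lambda>j. block_vec (f j) (q - 1))) \<le> CARD('d)"
proof (rule ccontr)
  let ?d = "CARD('d)"
  let ?A = "dim (range (\<lambda>j. block_vec (f j) p))" and ?A' = "dim (range (\<lambda>j. block_vec (f j) (q - 1)))"
  assume "\<not> (?A \<le> ?d \<or> ?A' \<le> ?d)"
  then have A: "?A > ?d" "?A' > ?d" by auto
  have d: "?d > 0" by simp
  have h: "orthonormal_translates 1 (\<lambda>j. blocks p (f j))" "parseval_translates 1 (\<lambda>j. blocks p (f j))" for p
    using orthonormal_translates_image[OF shift_isometry_blocks f(1,2)]
      parseval_translates_image[OF shift_isometry_blocks f(1,3)] by auto
  have mom: "(\<Sum>j\<in>UNIV. moment (blocks p (f j))) = - of_int p * ?d" for p
    using total_moment_blocks[OF f(1-3), of p] f(4) by (simp add: algebra_simps)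
  have "blocks p (f j) n = 0" if "n \<notin> {0..int N}" for j n
    by (rule block_outside[OF _ q that]) (use supp in auto)
  then have "- of_int p * real ?d \<le> real N * (2 * real ?d - real ?A)"
    using moment_le_codim_first[OF h(1)[of p] h(2)[of p], of N] unfolding mom by (simp add: blocks_def)
  also have "\<dots> < real N * ?d"
    using A(1) N by (intro mult_strict_left_mono) auto
  finally have "real_of_int (- p) < real_of_int (int N)"
    using d mult_less_cancel_right_pos[of "real ?d" "- of_int p" "real N"] by simp
  then have p: "- p < int N" by (simp only: of_int_less_iff)
  have "blocks (p - 1) (f j) n = 0" if "n \<notin> {0..int N}" for j n
    by (rule block_outside[OF _ _ that, of _ "q - 1"]) (use supp q in auto)
  then have "real N * real ?A' \<le> of_int (1 - p) * real ?d"
    using moment_ge_dim_last[OF h(1)[of "p - 1"] h(2)[of "p - 1"], of N] unfolding mom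
    by (simp add: blocks_def q algebra_simps)
  moreover have "real N * ?d < real N * ?A'"
    using A(2) N by (intro mult_strict_left_mono) auto
  ultimately have "real N * real ?d < of_int (1 - p) * real ?d" by linarith
  then have "real_of_int (int N) < real_of_int (1 - p)"
    using d mult_less_cancel_right_pos[of "real ?d" "real N" "of_int (1 - p)"] by simp
  then have "int N < 1 - p" by (simp only: of_int_less_iff)
  with p show False by simp
qed

lemma block_dim_eq: "block_dim a b m = dim (range (\<lambda>j. block_vec (case_sum a b j) m))"
proof -
  have "range (\<lambda>l. block_vec (a l) m) \<union> range (\<lambda>l. block_vec (b l) m)
      = range (\<lambda>j. block_vec (case_sum a b j) m)"
    by (simp add: UNIV_sum image_Un image_image)
  then show ?thesis unfolding block_dim_def by simp
qed

lemma leftmost_block_eq: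
  assumes C: "C \<in> {even_covering, odd_covering}" and m: "m \<in> C" "m \<le> p" "p \<le> m + 1"
    and pq: "support_interval a b = {p..q}" "p \<le> q"
  shows "leftmost_block C a b = m"
  unfolding leftmost_block_def
proof (rule Min_eqI)
  have "{x \<in> C. {x, x + 1} \<inter> support_interval a b \<noteq> {}} \<subseteq> {p - 1..q}" by (auto simp: pq)
  then show "finite {x \<in> C. {x, x + 1} \<inter> support_interval a b \<noteq> {}}"
    by (rule finite_subset) simp
  show "m \<in> {x \<in> C. {x, x + 1} \<inter> support_interval a b \<noteq> {}}"
    using m pq by auto
  fix x assume "x \<in> {x \<in> C. {x, x + 1} \<inter> support_interval a b \<noteq> {}}"
  then have "x \<in> C" "p \<le> x + 1" by (auto simp: pq)
  moreover from this have "even (x - m)" using C m by (auto simp: even_covering_def odd_covering_def)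
  ultimately show "m \<le> x" using m by presburger
qed

lemma rightmost_block_eq:
  assumes C: "C \<in> {even_covering, odd_covering}" and m: "m \<in> C" "m \<le> q" "q \<le> m + 1"
    and pq: "support_interval a b = {p..q}" "p \<le> q"
  shows "rightmost_block C a b = m"
  unfolding rightmost_block_def
proof (rule Max_eqI)
  have "{x \<in> C. {x, x + 1} \<inter> support_interval a b \<noteq> {}} \<subseteq> {p - 1..q}" by (auto simp: pq)
  then show "finite {x \<in> C. {x, x + 1} \<inter> support_interval a b \<noteq> {}}"
    by (rule finite_subset) simp
  show "m \<in> {x \<in> C. {x, x + 1} \<inter> support_interval a b \<noteq> {}}"
    using m pq by auto
  fix x assume "x \<in> {x \<in> C. {x, x + 1} \<inter> support_interval a b \<noteq> {}}"
  then have "x \<in> C" "x \<le> q" by (auto simp: pq)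
  moreover from this have "even (x - m)" using C m by (auto simp: even_covering_def odd_covering_def)
  ultimately show "x \<le> m" using m by presburger
qed

lemma covering_containing: "\<exists>C\<in>{even_covering, odd_covering}. m \<in> C"
  by (auto simp: even_covering_def odd_covering_def)

lemma covering_closed:
  "C \<in> {even_covering, odd_covering} \<Longrightarrow> m \<in> C \<Longrightarrow> even (n - m) \<Longrightarrow> n \<in> C"
  by (auto simp: even_covering_def odd_covering_def)

lemma support_interval_bounds:
  assumes fin: "finite (qmf_support a b)" and on: "orthonormal_translates t (case_sum a b)"
  obtains p q where "support_interval a b = {p..q}" "p \<le> q"
    "\<And>j k. k \<notin> {p..q} \<Longrightarrow> case_sum a b j k = 0"
proof -
  have supp: "qmf_support a b = {k. \<exists>j. case_sum a b j k \<noteq> 0}"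
    unfolding qmf_support_def split_sum_ex by auto
  have "qmf_support a b \<noteq> {}"
  proof
    assume "qmf_support a b = {}"
    then have "case_sum a b j = (\<lambda>k. 0)" for j using supp by auto
    then show False
      using orthonormal_translates_norm[OF on] by (simp add: l2_inner_def)
  qed
  then have "Min (qmf_support a b) \<le> Max (qmf_support a b)"
    using fin by (meson Max_ge Min_in)
  moreover have "case_sum a b j k = 0" if "k \<notin> {Min (qmf_support a b)..Max (qmf_support a b)}" for j k
  proof (rule ccontr)
    assume "case_sum a b j k \<noteq> 0"
    then have "k \<in> qmf_support a b" using supp by blast
    with fin that show False by auto
  qed
  ultimately show ?thesis using that unfolding support_interval_def by blast
qed

lemma finite_qmf_support:
  assumes "\<And>j. finsupp (case_sum a b j)"
  shows "finite (qmf_support a b)"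
proof -
  have "qmf_support a b = (\<Union>l. {k. a l k \<noteq> 0}) \<union> (\<Union>l. {k. b l k \<noteq> 0})"
    by (auto simp: qmf_support_def)
  then show ?thesis
    using assms[of "Inl _"] assms[of "Inr _"] by (simp add: finsupp_def)
qed

text \<open>An outermost block of which only one position meets the support is harmless, and at either end
  one of the two coverings has such a block. Only when these coverings differ, that is
  when both ends of the support have the same parity, does the moment enter.\<close>
lemma obtainable_outermost_block_dim:
  fixes a b :: "'d::finite \<Rightarrow> 'd vseq"
  assumes "obtainable a b"
  shows "\<exists>C\<in>{even_covering, odd_covering}.
           block_dim a b (leftmost_block C a b) \<le> CARD('d) \<and>
           block_dim a b (rightmost_block C a b) \<le> CARD('d)"
proof -
  let ?f = "case_sum a b"
  note inv = reachable_invariants[OF assms[unfolded obtainable_iff_reachable]]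
  obtain p q where pq: "support_interval a b = {p..q}" "p \<le> q"
    and supp: "\<And>j k. k \<notin> {p..q} \<Longrightarrow> ?f j k = 0"
    using support_interval_bounds[OF finite_qmf_support[OF inv(1)] inv(2)] by blast
  have before: "block_dim a b (p - 1) \<le> CARD('d)" and after: "block_dim a b q \<le> CARD('d)"
    unfolding block_dim_eq by (rule dim_half_block; use supp in auto)+
  obtain C where C: "C \<in> {even_covering, odd_covering}" "p \<in> C"
    using covering_containing by blast
  obtain C' where C': "C' \<in> {even_covering, odd_covering}" "p - 1 \<in> C'"
    using covering_containing by blast
  note left = leftmost_block_eq[OF C _ _ pq] leftmost_block_eq[OF C' _ _ pq]
  show ?thesis
  proof (cases "even (q - p)")
    case False
    then have "q \<in> C'" using covering_closed[OF C', of q] by simp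
    then have "rightmost_block C' a b = q" using rightmost_block_eq[OF C'(1) _ _ _ pq] by simp
    then show ?thesis using left(2) before after C' by auto
  next
    case True
    then obtain n where "q - p = 2 * n" by (elim evenE)
    then have "q = p + 2 * int (nat n)" using pq(2) by simp
    then obtain N where q: "q = p + 2 * int N" by blast
    have "q \<in> C" "q - 1 \<in> C'" using covering_closed[OF C, of q] covering_closed[OF C', of "q - 1"] q by auto
    then have right: "rightmost_block C a b = q" "rightmost_block C' a b = q - 1"
      using rightmost_block_eq[OF C(1) _ _ _ pq] rightmost_block_eq[OF C'(1) _ _ _ pq] by simp_all
    have "block_dim a b p \<le> CARD('d) \<or> block_dim a b (q - 1) \<le> CARD('d)"
    proof (cases "N = 0")
      case True
      then show ?thesis using after q by simp
    next
      case False
      then show ?thesis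
        using moment_forces_small_end[OF inv supp q] unfolding block_dim_eq by simp
    qed
    then show ?thesis using left right before after C C' by auto
  qed
qed

section \<open>Peeling off the outermost blocks\<close>

lemma qmf_orthonormal: "qmf_system a b \<Longrightarrow> orthonormal_translates 2 (case_sum a b)"
proof -
  assume "qmf_system a b"
  then have *: "l2_inner ((\<lambda>(j, m). translate (2 * m) (case_sum a b j)) x)
                  ((\<lambda>(j, m). translate (2 * m) (case_sum a b j)) y) = (if x = y then 1 else 0)" for x y
    unfolding qmf_system_def l2_orthonormal_basis_def by blast
  show ?thesis
    unfolding orthonormal_translates_def
  proof (intro allI)
    fix i j and m :: int
    show "l2_inner (case_sum a b i) (translate (2 * m) (case_sum a b j)) = (if i = j \<and> m = 0 then 1 else 0)"
      using *[of "(i, 0)" "(j, m)"] by (auto simp: translate_def)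
  qed
qed

lemma translate_0: "translate 0 s = s"
  by (simp add: translate_def)

lemma reachable_trivial: "reachable trivial_system"
  unfolding reachable_def by (rule exI[of _ 0]) simp

text \<open>On a single block of the even covering the system is an orthogonal matrix, namely the rotation
  that produces it from the trivial system.\<close>
lemma reachable_if_supported_on_one_block:
  fixes f :: "'d::finite + 'd \<Rightarrow> 'd vseq"
  assumes on: "orthonormal_translates 2 f" and supp: "\<And>j k. k \<notin> {0..1} \<Longrightarrow> f j k = 0"
  shows "reachable f"
proof -
  let ?M = "\<chi> i j. block_vec (f j) 0 $ i"
  have col: "column j ?M = blocks 0 (f j) 0" for j
    by (simp add: column_def blocks_def vec_eq_iff)
  have fin: "finsupp (f j)" for j by (rule finsupp_interval[OF supp])
  have z: "blocks 0 (f j) n = 0" if "n \<noteq> 0" for j n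
    by (rule block_outside[of 0 0 _ 0]) (use supp that in auto)
  have "orthonormal_translates 1 (\<lambda>j. blocks 0 (f j))"
    by (rule orthonormal_translates_image[OF shift_isometry_blocks fin on])
  then have "l2_inner (blocks 0 (f i)) (blocks 0 (f j)) = (if i = j then 1 else 0)" for i j
    unfolding orthonormal_translates_def by (metis mult_zero_right translate_0)
  moreover have "l2_inner (blocks 0 (f i)) (blocks 0 (f j)) = column i ?M \<bullet> column j ?M" for i j
    unfolding col by (rule l2_inner_single) (simp add: z)
  ultimately have "column i ?M \<bullet> column j ?M = (if i = j then 1 else 0)" for i j by simp
  then have M: "orthogonal_matrix ?M"
    unfolding orthogonal_matrix_orthonormal_columns by (simp add: norm_eq_1 orthogonal_def)
  have "f j = rotate_blocks 0 ?M (trivial_system j)" for j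
  proof (rule blocks_eqD[of 0])
    have "blocks 0 (f j) n = ?M *v blocks 0 (trivial_system j) n" for n
      using z[of n j] by (auto simp: blocks_trivial matrix_vector_mult_basis col)
    then show "blocks 0 (f j) = blocks 0 (rotate_blocks 0 ?M (trivial_system j))"
      using blocks_rotate[of 0 ?M "trivial_system j"] by auto
  qed
  then have "f = (\<lambda>j. rotate_blocks 0 ?M (trivial_system j))" by blast
  then show ?thesis
    using reachable_rotate[OF reachable_trivial _ M, of 0] by simp
qed

lemma inner_span_eq_0:
  fixes S T :: "'a::euclidean_space set"
  assumes ST: "\<And>x y. x \<in> S \<Longrightarrow> y \<in> T \<Longrightarrow> x \<bullet> y = 0" and xy: "x \<in> span S" "y \<in> span T"
  shows "x \<bullet> y = 0"
proof -
  have "orthogonal y x'" if "x' \<in> S" for x'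
  proof -
    have "orthogonal x' y"
      by (rule orthogonal_to_span[OF xy(2)]) (simp add: orthogonal_def ST that)
    then show ?thesis by (simp add: orthogonal_commute)
  qed
  then have "orthogonal y x" by (rule orthogonal_to_span[OF xy(1)])
  then show ?thesis by (simp add: orthogonal_def inner_commute)
qed

text \<open>The dimensions of the orthogonal spaces \<open>S\<close> and \<open>T\<close> add up to at most \<open>2 * CARD('d)\<close>, so both equal
  \<open>CARD('d)\<close>, and orthonormal bases of \<open>T\<close> and of \<open>S\<close> make up the rows of the rotation.\<close>
lemma ex_rotation_into_halves:
  fixes S T :: "(real ^ ('d::finite + 'd)) set"
  assumes ST: "\<And>x y. x \<in> S \<Longrightarrow> y \<in> T \<Longrightarrow> x \<bullet> y = 0"
    and dim: "dim S \<ge> CARD('d)" "dim T \<ge> CARD('d)"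
  obtains M :: "real ^ ('d + 'd) ^ ('d + 'd)" where "orthogonal_matrix M"
    "\<And>x i. x \<in> S \<Longrightarrow> (M *v x) $ Inl i = 0" "\<And>y i. y \<in> T \<Longrightarrow> (M *v y) $ Inr i = 0"
proof -
  obtain B where B: "orthonormal_set B" "card B = dim S" "span B = span S"
    by (rule orthonormal_basis_of_span)
  obtain C where C: "orthonormal_set C" "card C = dim T" "span C = span T"
    by (rule orthonormal_basis_of_span)
  have orth: "x \<bullet> y = 0" if "x \<in> span S" "y \<in> span T" for x y
    using inner_span_eq_0[of S T x y] ST that by blast
  have BS: "b \<in> span S" if "b \<in> B" for b using that B(3) span_base by blast
  have CT: "c \<in> span T" if "c \<in> C" for c using that C(3) span_base by blast
  have fin: "finite B" "finite C" using B(1) C(1) by (auto simp: orthonormal_set_def)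
  have cross: "b \<bullet> c = 0" if "b \<in> B" "c \<in> C" for b c
    using orth[OF BS[OF that(1)] CT[OF that(2)]] .
  have disj: "B \<inter> C = {}" using cross B(1) unfolding orthonormal_set_def by fastforce
  have cross': "c \<bullet> b = 0" if "b \<in> B" "c \<in> C" for b c
    using cross[OF that] by (simp add: inner_commute)
  have on: "x \<bullet> y = (if x = y then 1 else 0)" if "x \<in> B \<union> C" "y \<in> B \<union> C" for x y
  proof -
    have "x \<in> B \<Longrightarrow> y \<in> C \<Longrightarrow> x \<noteq> y" "x \<in> C \<Longrightarrow> y \<in> B \<Longrightarrow> x \<noteq> y"
      using disj by auto
    then show ?thesis
      using that B(1) C(1) cross[of x y] cross'[of y x] unfolding orthonormal_set_def by auto
  qed
  have "pairwise orthogonal (B \<union> C)" using on by (simp add: pairwise_def orthogonal_def)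
  moreover have "0 \<notin> B \<union> C" using on[of 0 0] by auto
  ultimately have "independent (B \<union> C)" by (rule pairwise_orthogonal_independent)
  then have "card (B \<union> C) \<le> CARD('d + 'd)"
    using independent_bound[of "B \<union> C"] by simp
  then have "card B + card C \<le> 2 * CARD('d)"
    using card_Un_disjoint[OF fin disj] by simp
  then have "card B = CARD('d)" "card C = CARD('d)"
    using dim B(2) C(2) by auto
  then obtain u v :: "'d \<Rightarrow> real ^ ('d + 'd)" where u: "bij_betw u UNIV B" and v: "bij_betw v UNIV C"
    using fin finite_same_card_bij[of "UNIV :: 'd set"] by (metis finite)
  let ?M = "\<chi> j. case j of Inl i \<Rightarrow> v i | Inr i \<Rightarrow> u i"
  have uB: "u i \<in> B" and vC: "v i \<in> C" and inj: "u i = u j \<longleftrightarrow> i = j" "v i = v j \<longleftrightarrow> i = j" for i j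
    using u v by (auto simp: bij_betw_def inj_eq)
  have row: "row j ?M = (case j of Inl i \<Rightarrow> v i | Inr i \<Rightarrow> u i)" for j
    by (simp add: row_def)
  have "row i ?M \<bullet> row j ?M = (if i = j then 1 else 0)" for i j
    using uB vC B(1) C(1) cross inj unfolding row orthonormal_set_def
    by (cases i; cases j) (auto simp: inner_commute)
  then have "orthogonal_matrix ?M"
    unfolding orthogonal_matrix_orthonormal_rows by (simp add: norm_eq_1 orthogonal_def)
  moreover have "(?M *v x) $ Inl i = 0" if "x \<in> S" for x i
    using orth[OF span_base[OF that] CT[OF vC]] by (simp add: matrix_mult_dot inner_commute)
  moreover have "(?M *v y) $ Inr i = 0" if "y \<in> T" for y i
    using orth[OF BS[OF uB] span_base[OF that]] by (simp add: matrix_mult_dot)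
  ultimately show ?thesis using that by blast
qed

lemma dim_range_linear_le:
  fixes g :: "'j \<Rightarrow> 'a::euclidean_space" and h :: "'j \<Rightarrow> 'b::euclidean_space"
  assumes "linear L" "\<And>j. h j = L (g j)"
  shows "dim (range h) \<le> dim (range g)"
proof -
  have "range h = L ` range g" by (auto simp: assms(2))
  then show ?thesis using dim_image_le[OF assms(1)] by metis
qed

text \<open>The two outermost blocks span orthogonal spaces of half dimension. A rotation takes the left one
  into the lower and the right one into the upper half, which empties the outer position at both
  ends, and the support fits the blocks of the opposite covering from \<open>- R + 1\<close> to \<open>R - 1\<close>. The new
  outermost blocks contain the surviving halves, so their dimensions are again at least
  \<open>CARD('d)\<close>. Only lower bounds are carried along, since orthogonality provides the
  upper ones.\<close>
lemma reachable_if_ends_full: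
  fixes f :: "'d::finite + 'd \<Rightarrow> 'd vseq"
  assumes "orthonormal_translates 2 f"
    and "\<And>j k. k \<notin> {- int R..int R + 1} \<Longrightarrow> f j k = 0"
    and "R > 0 \<Longrightarrow> CARD('d) \<le> dim (range (\<lambda>j. block_vec (f j) (- int R)))"
    and "R > 0 \<Longrightarrow> CARD('d) \<le> dim (range (\<lambda>j. block_vec (f j) (int R)))"
  shows "reachable f"
  using assms
proof (induction R arbitrary: f)
  case 0
  have "f j k = 0" if "k \<notin> {0..1}" for j k
    using "0.prems"(2)[of k j] that by simp
  then show ?case by (rule reachable_if_supported_on_one_block[OF "0.prems"(1)])
next
  case (Suc R)
  define r where "r = int (Suc R)"
  \<comment> \<open>The covering that contains the blocks with left endpoints \<open>- r\<close> and \<open>r\<close>.\<close>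
  define e where "e = Suc R mod 2"
  have e: "e \<in> {0, 1}" and r: "even (r - int e)" "even (- r - int e)"
    unfolding e_def r_def by (auto simp: even_nat_iff)
  have supp: "f j k = 0" if "k < - r \<or> k > r + 1" for j k
    using Suc.prems(2)[of k j] that by (auto simp: r_def)
  have fin: "finsupp (f j)" for j by (rule finsupp_interval[OF Suc.prems(2)])
  let ?S = "range (\<lambda>j. block_vec (f j) (- r))" and ?T = "range (\<lambda>j. block_vec (f j) r)"
  have ends: "block_vec (f i) (- r) \<bullet> block_vec (f j) r = 0" for i j
  proof -
    have "orthonormal_translates 1 (\<lambda>j. blocks (- r) (f j))"
      by (rule orthonormal_translates_image[OF shift_isometry_blocks fin Suc.prems(1)])
    moreover have "blocks (- r) (f j) n = 0" if "n \<notin> {0..r}" for j n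
      by (rule block_outside[of "- r" r _ "Suc R"]) (use that supp in \<open>auto simp: r_def\<close>)
    moreover have "r > 0" unfolding r_def by simp
    ultimately have "blocks (- r) (f i) 0 \<bullet> blocks (- r) (f j) r = 0"
      by (rule orthonormal_ends_orthogonal)
    then show ?thesis by (simp add: blocks_def)
  qed
  have ST: "x \<bullet> y = 0" if "x \<in> ?S" "y \<in> ?T" for x y
    using that ends by auto
  have dim: "CARD('d) \<le> dim ?S" "CARD('d) \<le> dim ?T"
    using Suc.prems(3,4) unfolding r_def by auto
  obtain M :: "real ^ ('d + 'd) ^ ('d + 'd)" where M: "orthogonal_matrix M"
    and S: "\<And>x i. x \<in> ?S \<Longrightarrow> (M *v x) $ Inl i = 0" and T: "\<And>y i. y \<in> ?T \<Longrightarrow> (M *v y) $ Inr i = 0"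
    using ex_rotation_into_halves[OF ST dim] by blast
  have left: "(M *v block_vec (f j) (- r)) $ Inl i = 0"
    and right: "(M *v block_vec (f j) r) $ Inr i = 0" for j i
    by (rule S, blast, rule T, blast)
  let ?g = "\<lambda>j. rotate_blocks e M (f j)"
  have g: "block_vec (?g j) m = M *v block_vec (f j) m" if "even (m - r)" for j m
    by (rule block_vec_rotate[OF e]) (use that r in \<open>presburger\<close>)
  have gl: "?g j (- r) = 0" for j
  proof -
    have "block_vec (?g j) (- r) $ Inl i = 0" for i by (simp add: g left)
    then show ?thesis by (simp add: vec_eq_iff block_vec_def)
  qed
  have gr: "?g j (r + 1) = 0" for j
  proof -
    have "block_vec (?g j) r $ Inr i = 0" for i by (simp add: g right)
    then show ?thesis by (simp add: vec_eq_iff block_vec_def)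
  qed
  have supp_g: "?g j k = 0" if k: "k \<notin> {- int R..int R + 1}" for j k
  proof (cases "k = - r \<or> k = r + 1")
    case True
    then show ?thesis using gl gr by auto
  next
    case False
    \<comment> \<open>The left endpoint of the block at \<open>k\<close> in the covering of \<open>r\<close>.\<close>
    define m where "m = k - (k - r) mod 2"
    have m: "even (m - r)" "k = m \<or> k = m + 1" unfolding m_def by presburger+
    have "k < - r \<or> k > r + 1" using False k unfolding r_def by auto
    with m have "m < - r - 1 \<or> m > r + 1" by presburger
    then have "block_vec (f j) m = 0" using supp[of m j] supp[of "m + 1" j]
      unfolding block_vec_eq_0_iff by auto
    then have "block_vec (?g j) m = 0" using g[OF m(1)] by simp
    then show ?thesis using m(2) unfolding block_vec_eq_0_iff by auto
  qed
  have unrotate: "block_vec (f j) m = transpose M *v block_vec (?g j) m" if "even (m - r)" for j m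
    using M by (simp add: g[OF that] matrix_vector_mul_assoc orthogonal_matrix_def)
  have "reachable ?g"
  proof (rule Suc.IH)
    show "orthonormal_translates 2 ?g"
      by (rule orthonormal_translates_image[OF shift_isometry_rotate[OF e M] fin Suc.prems(1)])
    show "?g j k = 0" if "k \<notin> {- int R..int R + 1}" for j k
      by (rule supp_g[OF that])
    \<comment> \<open>One half of an old outermost block is empty after rotation, the other is half of the new one.\<close>
    let ?up = "\<lambda>x :: real ^ ('d + 'd). (\<chi> j. case j of Inl i \<Rightarrow> x $ Inr i | Inr i \<Rightarrow> 0) :: real ^ ('d + 'd)"
    let ?dn = "\<lambda>x :: real ^ ('d + 'd). (\<chi> j. case j of Inl i \<Rightarrow> 0 | Inr i \<Rightarrow> x $ Inl i) :: real ^ ('d + 'd)"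
    have lin: "linear ?up" "linear ?dn"
      by (auto intro!: linearI simp: vec_eq_iff split: sum.split)
    have "dim ?S \<le> dim (range (\<lambda>j. block_vec (?g j) (- int R)))"
    proof (rule dim_range_linear_le)
      show "linear (\<lambda>x. transpose M *v ?dn x)"
        using linear_compose[OF lin(2) matrix_vector_mul_linear[of "transpose M"]] unfolding o_def .
      have "block_vec (?g j) (- r) $ i = ?dn (block_vec (?g j) (- int R)) $ i" for i j
        using gl[of j] by (cases i) (simp_all add: block_vec_def r_def)
      then have "block_vec (?g j) (- r) = ?dn (block_vec (?g j) (- int R))" for j
        unfolding vec_eq_iff by blast
      then show "block_vec (f j) (- r) = transpose M *v ?dn (block_vec (?g j) (- int R))" for j
        using unrotate[of "- r" j] by simp
    qed
    then show "CARD('d) \<le> dim (range (\<lambda>j. block_vec (?g j) (- int R)))"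
      using Suc.prems(3) unfolding r_def by simp
    have "dim ?T \<le> dim (range (\<lambda>j. block_vec (?g j) (int R)))"
    proof (rule dim_range_linear_le)
      show "linear (\<lambda>x. transpose M *v ?up x)"
        using linear_compose[OF lin(1) matrix_vector_mul_linear[of "transpose M"]] unfolding o_def .
      have "block_vec (?g j) r $ i = ?up (block_vec (?g j) (int R)) $ i" for i j
        using gr[of j] by (cases i) (simp_all add: block_vec_def r_def algebra_simps)
      then have "block_vec (?g j) r = ?up (block_vec (?g j) (int R))" for j
        unfolding vec_eq_iff by blast
      then show "block_vec (f j) r = transpose M *v ?up (block_vec (?g j) (int R))" for j
        using unrotate[of r j] by simp
    qed
    then show "CARD('d) \<le> dim (range (\<lambda>j. block_vec (?g j) (int R)))"
      using Suc.prems(4) unfolding r_def by simp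
  qed
  then have "reachable (\<lambda>j. rotate_blocks e (transpose M) (?g j))"
    by (rule reachable_rotate[OF _ e]) (simp add: M)
  then show ?case by (simp add: rotate_blocks_transpose[OF e M])
qed

text \<open>The translation moves the outermost blocks to the left endpoints \<open>- R\<close> and \<open>R\<close>. If the centre is odd
  it exchanges the two coverings, which is immaterial to the induction.\<close>
lemma full_outermost_blocks_obtainable:
  fixes a b :: "'d::finite \<Rightarrow> 'd vseq"
  assumes C: "C \<in> {even_covering, odd_covering}" and qmf: "qmf_system a b"
    and fin: "finite (qmf_support a b)"
    and dim: "block_dim a b (leftmost_block C a b) = CARD('d)"
      "block_dim a b (rightmost_block C a b) = CARD('d)"
  shows "obtainable (\<lambda>l. translate (- covering_centre C a b) (a l))
                    (\<lambda>l. translate (- covering_centre C a b) (b l))"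
proof -
  let ?f = "case_sum a b"
  note on = qmf_orthonormal[OF qmf]
  obtain p q where pq: "support_interval a b = {p..q}" "p \<le> q"
    and supp: "\<And>j k. k \<notin> {p..q} \<Longrightarrow> ?f j k = 0"
    using support_interval_bounds[OF fin on] by blast
  have ex: "\<exists>m\<in>C. m \<le> k \<and> k \<le> m + 1" for k :: int
  proof (cases "k \<in> C")
    case True
    then show ?thesis by auto
  next
    case False
    then have "k - 1 \<in> C" using C by (auto simp: even_covering_def odd_covering_def)
    then show ?thesis by (intro bexI[of _ "k - 1"]) auto
  qed
  obtain L where L: "L \<in> C" "L \<le> p" "p \<le> L + 1" using ex by blast
  obtain T where T: "T \<in> C" "T \<le> q" "q \<le> T + 1" using ex by blast
  have ends: "leftmost_block C a b = L" "rightmost_block C a b = T"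
    using leftmost_block_eq[OF C L pq] rightmost_block_eq[OF C T pq] by auto
  have "even (L + T)" using C L(1) T(1) by (auto simp: even_covering_def odd_covering_def)
  then obtain c where c: "L + T = 2 * c" by (elim evenE)
  have centre: "covering_centre C a b = c"
    unfolding covering_centre_def ends c by simp
  have "L \<le> T" using c L(2,3) T(2,3) pq(2) by presburger
  then obtain R where "T - c = int R"
    using c zero_le_imp_eq_int[of "T - c"] by auto
  with c have R: "T - c = int R" "L - c = - int R" by auto
  let ?g = "\<lambda>j. translate (- c) (?f j)"
  have finf: "finsupp (?f j)" for j by (rule finsupp_interval[OF supp])
  have "reachable ?g"
  proof (rule reachable_if_ends_full)
    show "orthonormal_translates 2 ?g"
      by (rule orthonormal_translates_image[OF shift_isometry_translate finf on])
    show "?g j k = 0" if "k \<notin> {- int R..int R + 1}" for j k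
    proof -
      have "k + c \<notin> {p..q}" using that R L T by auto
      from supp[OF this] show ?thesis by (simp add: translate_def)
    qed
    have "- int R + c = L" "int R + c = T" using R by auto
    then show "CARD('d) \<le> dim (range (\<lambda>j. block_vec (?g j) (- int R)))"
      "CARD('d) \<le> dim (range (\<lambda>j. block_vec (?g j) (int R)))"
      using dim unfolding block_vec_translate ends block_dim_eq by simp_all
  qed
  moreover have "?g = case_sum (\<lambda>l. translate (- c) (a l)) (\<lambda>l. translate (- c) (b l))"
    by (rule ext) (simp split: sum.split)
  ultimately show ?thesis unfolding obtainable_iff_reachable centre by simp
qed

theorem theorem1:
  shows "(\<forall>a b :: 'd::finite \<Rightarrow> 'd vseq.
            qmf_system a b \<and> obtainable a b \<longrightarrow>
            (\<exists>C\<in>{even_covering, odd_covering}.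
               block_dim a b (leftmost_block C a b) \<le> CARD('d) \<and>
               block_dim a b (rightmost_block C a b) \<le> CARD('d))) \<and>
         (\<forall>a b :: 'd \<Rightarrow> 'd vseq. \<forall>C\<in>{even_covering, odd_covering}.
            qmf_system a b \<and> finite (qmf_support a b) \<and>
            block_dim a b (leftmost_block C a b) = CARD('d) \<and>
            block_dim a b (rightmost_block C a b) = CARD('d) \<longrightarrow>
            obtainable (\<lambda>l. translate (- covering_centre C a b) (a l))
                       (\<lambda>l. translate (- covering_centre C a b) (b l)))"
  using obtainable_outermost_block_dim full_outermost_blocks_obtainable by blast

end
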